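(* Let $K$ be a field, $P=K[x_1,\dots,x_n]$, $I\subset P$ a 0-dimensional ideal, and $R=P/I$. If there exists an element $\varphi\in G_{-\mathrm{ri}(R)}\omega_R$ such that $\mathrm{Ann}_R(\varphi)=\{0\}$, then $$\mathrm{HF}^a_R(i)+\mathrm{HF}^a_R(\mathrm{ri}(R)-1-i)\;\le\;\dim_K(R)$$ for $i=0,\dots,\mathrm{ri}(R)-1$. In particular, these inequalities hold if $K$ is infinite and $R$ is a locally Gorenstein ring with the Cayley-Bacharach property.
   Context: Setting: $I$ is a proper ideal of $P=K[x_1,\dots,x_n]$ such that $\dim_K(P/I)<\infty$; $R=P/I$ is always considered with this fixed presentation. Degree filtration: $F_iP=\{f\in P\mid \deg f\le i\}\cup\{0\}$, $F_iI=F_iP\cap I$, and $F_iR=F_iP/F_iI$ is the image of $F_iP$ in $R$ ($i\in\mathbb Z$). $\mathrm{HF}^a_R(i)=\dim_K F_iR$ is the affine Hilbert function. The regularity index is $\mathrm{ri}(R)=\min\{i\in\mathbb Z\mid \mathrm{HF}^a_R(j)=\dim_K R \text{ for all } j\ge i\}$. For $f\in R\setminus\{0\}$, $\mathrm{ord}_{\mathcal F}(f)=\min\{i\mid f\in F_iR\}$. Canonical module: $\omega_R=\mathrm{Hom}_K(R,K)$ with $(f\cdot\varphi)(g)=\varphi(fg)$; $G_i\omega_R=\{\varphi\in\omega_R\mid\varphi(F_{-i-1}R)=0\}$. Cayley-Bacharach property (CBP): let $I=\mathfrak Q_1\cap\dots\cap\mathfrak Q_s$ be the primary decomposition, $\mathfrak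 M_i=\mathrm{Rad}(\mathfrak Q_i)$ (maximal ideals), $\ell_i=\dim_K(P/\mathfrak M_i)$. A $\mathfrak Q_i$-divisor of $I$ is an ideal $J=\mathfrak Q_1\cap\dots\cap\mathfrak Q_i'\cap\dots\cap\mathfrak Q_s$ ($\mathfrak Q_i$ replaced by $\mathfrak Q_i'$), where $\mathfrak Q_i'$ is an ideal of $P$ with $\mathfrak Q_i\subsetneq\mathfrak Q_i'$ (so $\mathfrak Q_i'\subseteq\mathfrak M_i$ or $\mathfrak Q_i'=P$). It is minimal if $\dim_K(J/I)=\ell_i$. For a minimal $\mathfrak Q_i$-divisor $J$ with image $\bar J=J/I$ in $R$, put $\mathrm{ri}(\bar J)=\max\{\mathrm{ord}_{\mathcal F}(f)\mid f\in\bar J\setminus\{0\}\}$. $R$ has the CBP if for every $i\in\{1,\dots,s\}$ and every minimal $\mathfrak Q_i$-divisor $J$ of $I$ we have $\mathrm{ri}(\bar J)=\mathrm{ri}(R)$. Locally Gorenstein: let $\mathfrak q_i$ be the image of $\mathfrak Q_i$ in $R$. A 0-dimensional local ring $(A,\mathfrak m)$ is Gorenstein if $\dim_{A/\mathfrak m}\mathrm{Ann}_A(\mathfrak m)=1$. $R$ is locally Gorenstein if every local ring $R/\mathfrak q_i$ is Gorenstein. *)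

theory Defs
  imports
    "HOL-Library.Poly_Mapping"
    "HOL-Algebra.QuotRing"
    "Jordan_Normal_Form.VS_Connect"
begin

text \<open>
  Multivariate polynomials over \<open>'k\<close> whose indeterminates are indexed by the finite type \<open>'n\<close>; an element of
  \<open>'n \<Rightarrow>\<^sub>0 nat\<close> is the exponent vector of a monomial. The abbreviation \<open>class_ring\<close> of
  \<open>Jordan_Normal_Form.VS_Connect\<close> turns this type (and the field \<open>'k\<close>) into a \<open>HOL-Algebra\<close> ring with
  carrier \<open>UNIV\<close>.
\<close>

type_synonym ('n, 'k) mpoly = "('n \<Rightarrow>\<^sub>0 nat) \<Rightarrow>\<^sub>0 'k"

definition monom_deg :: "('n::finite \<Rightarrow>\<^sub>0 nat) \<Rightarrow> nat" where
  "monom_deg m = (\<Sum>x\<in>UNIV. Poly_Mapping.lookup m x)"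

text \<open>Only meaningful for nonzero \<open>f\<close>.\<close>

definition total_deg :: "('n::finite, 'k::zero) mpoly \<Rightarrow> nat" where
  "total_deg f = Max (monom_deg ` Poly_Mapping.keys f)"

definition filt_P :: "int \<Rightarrow> ('n::finite, 'k::zero) mpoly set" where
  "filt_P i = {f. f \<noteq> 0 \<and> int (total_deg f) \<le> i} \<union> {0}"

section \<open>The algebra \<open>R = P/I\<close> and its degree filtration\<close>

definition residue_class :: "('n::finite, 'k::field) mpoly set \<Rightarrow> ('n, 'k) mpoly \<Rightarrow> ('n, 'k) mpoly set"
  where "residue_class I f = a_r_coset class_ring I f"

text \<open>
  The elements are the cosets of \<open>I\<close>. A single record carries both the ring structure
  of \<open>class_ring Quot I\<close> and the \<open>'k\<close>-vector space structure.
\<close>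

definition quot_alg :: "('n::finite, 'k::field) mpoly set \<Rightarrow> ('k, ('n, 'k) mpoly set) module" where
  "quot_alg I = ring.extend (class_ring Quot I)
     \<lparr>smult = (\<lambda>c A. residue_class I (Poly_Mapping.single 0 c) \<otimes>\<^bsub>class_ring Quot I\<^esub> A)\<rparr>"

definition dim_R :: "('n::finite, 'k::field) mpoly set \<Rightarrow> nat" where
  "dim_R I = vectorspace.dim (class_ring :: 'k ring) (quot_alg I)"

definition sub_dim :: "('n::finite, 'k::field) mpoly set \<Rightarrow> ('n, 'k) mpoly set set \<Rightarrow> nat" where
  "sub_dim I W = vectorspace.dim (class_ring :: 'k ring) ((quot_alg I)\<lparr>carrier := W\<rparr>)"

definition filt_R :: "('n::finite, 'k::field) mpoly set \<Rightarrow> int \<Rightarrow> ('n, 'k) mpoly set set" where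
  "filt_R I i = residue_class I ` filt_P i"

definition HF :: "('n::finite, 'k::field) mpoly set \<Rightarrow> int \<Rightarrow> nat" where
  "HF I i = sub_dim I (filt_R I i)"

definition ri :: "('n::finite, 'k::field) mpoly set \<Rightarrow> int" where
  "ri I = (LEAST i. \<forall>j\<ge>i. HF I j = dim_R I)"

definition ord_filt :: "('n::finite, 'k::field) mpoly set \<Rightarrow> ('n, 'k) mpoly set \<Rightarrow> int" where
  "ord_filt I f = (LEAST i. f \<in> filt_R I i)"

section \<open>The canonical module\<close>

definition field_module :: "('k::field, 'k) module" where
  "field_module = ring.extend class_ring \<lparr>smult = (*)\<rparr>"

text \<open>
  \<open>\<omega>\<^sub>R\<close> as a module over \<open>R\<close>. Linear forms on \<open>R\<close> are made extensional, so that equality of forms is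
  equality of functions. The fields \<open>mult\<close> and \<open>one\<close> of the record are irrelevant for a module.
\<close>

definition canonical_module ::
  "('n::finite, 'k::field) mpoly set \<Rightarrow> (('n, 'k) mpoly set, ('n, 'k) mpoly set \<Rightarrow> 'k) module" where
  "canonical_module I =
     \<lparr>carrier = LinearCombinations.module_hom class_ring (quot_alg I) field_module
                  \<inter> extensional (carrier (quot_alg I)),
      mult = undefined, one = undefined,
      zero = (\<lambda>g\<in>carrier (quot_alg I). 0),
      add = (\<lambda>\<phi> \<psi>. \<lambda>g\<in>carrier (quot_alg I). \<phi> g + \<psi> g),
      smult = (\<lambda>f \<phi>. \<lambda>g\<in>carrier (quot_alg I). \<phi> (f \<otimes>\<^bsub>quot_alg I\<^esub> g))\<rparr>"

definition filt_omega ::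
  "('n::finite, 'k::field) mpoly set \<Rightarrow> int \<Rightarrow> (('n, 'k) mpoly set \<Rightarrow> 'k) set" where
  "filt_omega I i = {\<phi> \<in> carrier (canonical_module I). \<forall>f\<in>filt_R I (- i - 1). \<phi> f = 0}"

definition ann_omega ::
  "('n::finite, 'k::field) mpoly set \<Rightarrow> (('n, 'k) mpoly set \<Rightarrow> 'k) \<Rightarrow> ('n, 'k) mpoly set set" where
  "ann_omega I \<phi> = {f \<in> carrier (quot_alg I).
     f \<odot>\<^bsub>canonical_module I\<^esub> \<phi> = \<zero>\<^bsub>canonical_module I\<^esub>}"

section \<open>Primary decomposition\<close>

definition primary_ideal :: "'a set \<Rightarrow> ('a, 'b) ring_scheme \<Rightarrow> bool" where
  "primary_ideal Q A \<longleftrightarrow> ideal Q A \<and> Q \<noteq> carrier A \<and>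
     (\<forall>a\<in>carrier A. \<forall>b\<in>carrier A.
        a \<otimes>\<^bsub>A\<^esub> b \<in> Q \<longrightarrow> a \<in> Q \<or> (\<exists>k::nat. b [^]\<^bsub>A\<^esub> k \<in> Q))"

definition radical :: "('a, 'b) ring_scheme \<Rightarrow> 'a set \<Rightarrow> 'a set" where
  "radical A Q = {a \<in> carrier A. \<exists>k::nat. a [^]\<^bsub>A\<^esub> k \<in> Q}"

text \<open>
  The set of components of an irredundant primary decomposition with pairwise different radicals.
  For a zero-dimensional ideal there is exactly one such set.
\<close>

definition primary_decomposition ::
  "('n::finite, 'k::field) mpoly set \<Rightarrow> ('n, 'k) mpoly set set \<Rightarrow> bool" where
  "primary_decomposition I \<Q> \<longleftrightarrow> finite \<Q> \<and> (\<forall>Q\<in>\<Q>. primary_ideal Q class_ring) \<and> \<Inter>\<Q> = I \<and>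
     inj_on (radical class_ring) \<Q> \<and> (\<forall>Q\<in>\<Q>. \<Inter>(\<Q> - {Q}) \<noteq> I)"

section \<open>The Cayley-Bacharach property\<close>

definition divisor ::
  "('n::finite, 'k::field) mpoly set set \<Rightarrow> ('n, 'k) mpoly set \<Rightarrow> ('n, 'k) mpoly set \<Rightarrow> bool" where
  "divisor \<Q> Q J \<longleftrightarrow> (\<exists>Q'. ideal Q' class_ring \<and> Q \<subset> Q' \<and> J = Q' \<inter> \<Inter>(\<Q> - {Q}))"

definition minimal_divisor ::
  "('n::finite, 'k::field) mpoly set \<Rightarrow> ('n, 'k) mpoly set set \<Rightarrow> ('n, 'k) mpoly set \<Rightarrow>
     ('n, 'k) mpoly set \<Rightarrow> bool" where
  "minimal_divisor I \<Q> Q J \<longleftrightarrow>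
     divisor \<Q> Q J \<and> sub_dim I (residue_class I ` J) = dim_R (radical class_ring Q)"

definition ri_ideal :: "('n::finite, 'k::field) mpoly set \<Rightarrow> ('n, 'k) mpoly set set \<Rightarrow> int" where
  "ri_ideal I Jbar = Max (ord_filt I ` (Jbar - {\<zero>\<^bsub>quot_alg I\<^esub>}))"

definition cayley_bacharach :: "('n::finite, 'k::field) mpoly set \<Rightarrow> bool" where
  "cayley_bacharach I \<longleftrightarrow> (\<forall>\<Q>. primary_decomposition I \<Q> \<longrightarrow>
     (\<forall>Q\<in>\<Q>. \<forall>J. minimal_divisor I \<Q> Q J \<longrightarrow> ri_ideal I (residue_class I ` J) = ri I))"

section \<open>Local Gorenstein rings\<close>

definition annihilator :: "('a, 'b) ring_scheme \<Rightarrow> 'a set \<Rightarrow> 'a set" where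
  "annihilator A S = {a \<in> carrier A. \<forall>x\<in>S. a \<otimes>\<^bsub>A\<^esub> x = \<zero>\<^bsub>A\<^esub>}"

text \<open>
  The annihilator of \<open>m\<close> in \<open>A\<close> as a vector space over \<open>A/m\<close>: all representatives \<open>a\<close> of a coset \<open>C\<close>
  of \<open>m\<close> give the same product \<open>a \<otimes> x\<close>, so the image of \<open>C\<close> below is a singleton.
\<close>

definition socle :: "('a, 'b) ring_scheme \<Rightarrow> 'a set \<Rightarrow> ('a set, 'a) module" where
  "socle A m = \<lparr>carrier = annihilator A m, mult = mult A, one = one A, zero = zero A, add = add A,
     smult = (\<lambda>C x. the_elem ((\<lambda>a. a \<otimes>\<^bsub>A\<^esub> x) ` C))\<rparr>"

definition gorenstein_local :: "('a, 'b) ring_scheme \<Rightarrow> bool" where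
  "gorenstein_local A \<longleftrightarrow> cring A \<and> (\<exists>m. {m'. maximalideal m' A} = {m} \<and>
     vectorspace.fin_dim (A Quot m) (socle A m) \<and> vectorspace.dim (A Quot m) (socle A m) = 1)"

definition locally_gorenstein :: "('n::finite, 'k::field) mpoly set \<Rightarrow> bool" where
  "locally_gorenstein I \<longleftrightarrow> (\<forall>\<Q>. primary_decomposition I \<Q> \<longrightarrow>
     (\<forall>Q\<in>\<Q>. gorenstein_local (quot_alg I Quot (residue_class I ` Q))))"

end

theory Submission
  imports Defs
begin

text \<open>
  A form \<open>\<phi>\<close> with trivial annihilator makes \<open>(f, g) \<mapsto> \<phi> (f g)\<close> nondegenerate on \<open>R\<close>. If \<open>\<phi>\<close> vanishes on
  \<open>F\<^sub>d R\<close>, then \<open>F\<^sub>d\<^sub>-\<^sub>i R\<close> is contained in the orthogonal complement of \<open>F\<^sub>i R\<close>, whose dimension is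
  \<open>dim R - dim F\<^sub>i R\<close>. The annihilator of \<open>\<phi>\<close> is the largest ideal in the kernel of \<open>\<phi>\<close>, so it is trivial once
  \<open>\<phi>\<close> vanishes on no minimal nonzero ideal of \<open>R\<close>. Every minimal nonzero ideal comes from a minimal divisor of
  \<open>I\<close>, so by the Cayley-Bacharach property it is not contained in \<open>F\<^sub>d R\<close> for \<open>d = ri R - 1\<close>; in a locally
  Gorenstein ring there are only finitely many of them. Over an infinite field some form kills \<open>F\<^sub>d R\<close> but none of
  these ideals, since a vector space is not a finite union of proper subspaces.
\<close>

section \<open>Linear algebra\<close>

text \<open>The computation takes place in \<open>P\<close>, not among cosets. A linear projection
  \<open>nf\<close> with kernel \<open>I\<close> picks one representative per coset, so a subspace
  of \<open>R\<close> becomes a subspace of \<open>range nf\<close>. As \<open>P\<close> itself is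
  infinite-dimensional, a finite spanning set accompanies \<open>nf\<close>. Forms on
  \<open>R\<close> appear as functionals on \<open>P\<close> that vanish on \<open>I\<close>.

  Two links carry the second claim. For \<open>A\<close> minimal over \<open>I\<close>, the quotient
  of \<open>A\<close> by \<open>I\<close> is a simple module, isomorphic to \<open>P\<close> modulo
  the maximal ideal I : A. A primary component not containing \<open>A\<close> has this ideal as its
  radical; hence there is exactly one such component, and the dimension is the one required of a
  minimal divisor. Modulo that component, \<open>A\<close> lands in the socle, a line over the
  residue field in the Gorenstein case, so each component accounts for at most one \<open>A\<close>.

  Both ring properties quantify over all primary decompositions and yield nothing unless one exists.
  Its construction rests on a maximal condition obtained by counting dimensions above
  \<open>I\<close>.\<close>

context vector_space
begin

lemma vector_space_mult: "vector_space ((*) :: 'a \<Rightarrow> 'a \<Rightarrow> 'a)"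
  by unfold_locales (auto simp: algebra_simps)

lemma vector_space_pair_mult: "vector_space_pair scale ((*) :: 'a \<Rightarrow> 'a \<Rightarrow> 'a)"
  by (intro vector_space_pair.intro vector_space_mult vector_space_axioms)

lemma exists_functional:
  assumes "subspace S" "a \<notin> S"
  obtains f where "Vector_Spaces.linear scale (*) f" "\<forall>x\<in>S. f x = 0" "f a \<noteq> 0"
proof -
  interpret L: vector_space_pair scale "(*) :: 'a \<Rightarrow> 'a \<Rightarrow> 'a"
    by (rule vector_space_pair_mult)
  obtain B where B: "B \<subseteq> S" "independent B" "S \<subseteq> span B"
    using maximal_independent_subset[of S] by blast
  have "span B = S" using B assms(1) span_subspace by blast
  with assms(2) have a: "a \<notin> span B" by blast
  then have "independent (insert a B)" using B(2) by (rule independent_insertI)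
  from L.linear_independent_extend[OF this, of "\<lambda>x. if x = a then 1 else 0"]
  obtain f where f: "Vector_Spaces.linear scale (*) f"
      "\<forall>x\<in>insert a B. f x = (if x = a then 1 else 0)" by blast
  have "\<forall>x\<in>B. f x = 0" using f(2) a span_base by auto
  then have "\<forall>x\<in>S. f x = 0"
    using L.linear_eq_0_on_span[OF f(1), of B] B(3) by blast
  with f show thesis using that by simp
qed

text \<open>The functional for \<open>insert a X\<close> is \<open>f + t g\<close>, where \<open>f\<close> works for \<open>X\<close> and \<open>g\<close> for \<open>a\<close>:
  each vector excludes at most one scalar \<open>t\<close>.\<close>

lemma exists_common_functional:
  assumes inf: "infinite (UNIV :: 'a set)" and S: "subspace S"
    and "finite X" "X \<inter> S = {}"
  shows "\<exists>f. Vector_Spaces.linear scale (*) f \<and> (\<forall>x\<in>S. f x = 0) \<and> (\<forall>x\<in>X. f x \<noteq> 0)"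
  using assms(3,4)
proof (induction X rule: finite_induct)
  case empty
  interpret L: vector_space_pair scale "(*) :: 'a \<Rightarrow> 'a \<Rightarrow> 'a"
    by (rule vector_space_pair_mult)
  show ?case using L.linear_zero by auto
next
  case (insert a X)
  interpret L: vector_space_pair scale "(*) :: 'a \<Rightarrow> 'a \<Rightarrow> 'a"
    by (rule vector_space_pair_mult)
  from insert obtain f where f: "Vector_Spaces.linear scale (*) f" "\<forall>x\<in>S. f x = 0" "\<forall>x\<in>X. f x \<noteq> 0"
    by auto
  from insert.prems have "a \<notin> S" by auto
  then obtain g where g: "Vector_Spaces.linear scale (*) g" "\<forall>x\<in>S. g x = 0" "g a \<noteq> 0"
    using exists_functional[OF S] by blast
  have "finite ((\<lambda>x. - f x / g x) ` insert a X)" using insert.hyps by simp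
  then obtain t where t: "t \<notin> (\<lambda>x. - f x / g x) ` insert a X"
    using inf ex_new_if_finite by blast
  show ?case
  proof (intro exI[of _ "\<lambda>x. f x + t * g x"] conjI ballI)
    show "Vector_Spaces.linear scale (*) (\<lambda>x. f x + t * g x)"
      by (intro L.linear_compose_add f g L.linear_compose_scale_right)
  next
    fix x assume "x \<in> insert a X"
    with t have *: "t \<noteq> - f x / g x" by auto
    show "f x + t * g x \<noteq> 0"
    proof (cases "g x = 0")
      case True
      with \<open>x \<in> insert a X\<close> f(3) g(3) show ?thesis by auto
    next
      case False
      with * show ?thesis by (metis add_eq_0_iff minus_divide_left nonzero_mult_div_cancel_right)
    qed
  qed (use f g in auto)
qed

text \<open>Biorthogonalisation, adding one functional at a time. Independence is required of the
  indexed family, so that later the index \<open>u\<close> can be a basis vector and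
  \<open>f u\<close> the functional it induces.\<close>

lemma exists_dual_family:
  fixes f :: "'c \<Rightarrow> 'b \<Rightarrow> 'a"
  assumes "finite B" and "\<And>u. u \<in> B \<Longrightarrow> Vector_Spaces.linear scale (*) (f u)"
    and "\<And>c. (\<And>g. (\<Sum>u\<in>B. c u * f u g) = 0) \<Longrightarrow> \<forall>u\<in>B. c u = 0"
  shows "\<exists>v. \<forall>u\<in>B. \<forall>w\<in>B. f u (v w) = (if u = w then 1 else 0)"
  using assms
proof (induction B rule: finite_induct)
  case empty
  then show ?case by simp
next
  case (insert b B)
  interpret L: vector_space_pair scale "(*) :: 'a \<Rightarrow> 'a \<Rightarrow> 'a"
    by (rule vector_space_pair_mult)
  note lin = insert.prems(1)
  have indep: "\<forall>u\<in>B. c u = 0" if "\<And>g. (\<Sum>u\<in>B. c u * f u g) = 0" for c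
  proof -
    have "(\<Sum>u\<in>insert b B. (c(b := 0)) u * f u g) = (\<Sum>u\<in>B. c u * f u g)" for g
      using insert.hyps by (auto intro!: sum.cong)
    with insert.prems(2)[of "c(b := 0)"] that have "\<forall>u\<in>insert b B. (c(b := 0)) u = 0" by presburger
    with insert.hyps show ?thesis by (metis fun_upd_other insertI2)
  qed
  with insert.IH lin obtain v where v: "\<forall>u\<in>B. \<forall>w\<in>B. f u (v w) = (if u = w then 1 else 0)"
    by auto
  \<comment> \<open>\<open>proj g\<close> is \<open>g\<close> corrected to lie in the kernel of
    every functional of \<open>B\<close>. If \<open>f b\<close> vanished on all these vectors, it
    would be a combination of the functionals of \<open>B\<close>.\<close>
  define proj where "proj g = g - (\<Sum>w\<in>B. scale (f w g) (v w))" for g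
  have f_proj: "f u (proj g) = f u g - (\<Sum>w\<in>B. f w g * f u (v w))" if "u \<in> insert b B" for u g
    using lin[OF that] by (simp add: proj_def L.linear_diff L.linear_sum L.linear_scale)
  have B_proj: "f u (proj g) = 0" if "u \<in> B" for u g
  proof -
    have "(\<Sum>w\<in>B. f w g * f u (v w)) = (\<Sum>w\<in>B. if u = w then f w g else 0)"
      using v that by (intro sum.cong) auto
    also have "\<dots> = f u g" using insert.hyps that by simp
    finally show ?thesis using f_proj[of u g] that by simp
  qed
  have "\<exists>g. f b (proj g) \<noteq> 0"
  proof (rule ccontr)
    assume "\<nexists>g. f b (proj g) \<noteq> 0"
    then have *: "f b g = (\<Sum>w\<in>B. f w g * f b (v w))" for g using f_proj[of b g] by simp
    define c where "c u = (if u = b then 1 else - f b (v u))" for u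
    have "(\<Sum>u\<in>B. c u * f u g) = (\<Sum>u\<in>B. - (f u g * f b (v u)))" for g
      using insert.hyps by (intro sum.cong) (auto simp: c_def)
    then have "(\<Sum>u\<in>insert b B. c u * f u g) = 0" for g
      using insert.hyps *[of g] by (simp add: c_def sum_negf)
    with insert.prems(2)[of c] have "c b = 0" by blast
    then show False by (simp add: c_def)
  qed
  then obtain g where g: "f b (proj g) \<noteq> 0" by blast
  define e where "e = scale (inverse (f b (proj g))) (proj g)"
  have e: "f u e = (if u = b then 1 else 0)" if "u \<in> insert b B" for u
    using that g B_proj[of u g] insert.hyps lin[OF that] by (auto simp: e_def L.linear_scale)
  \<comment> \<open>The old dual vectors need not be killed by \<open>f b\<close>; subtracting a
    multiple of \<open>e\<close> repairs this and is invisible to the functionals of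
    \<open>B\<close>.\<close>
  define v' where "v' w = (if w = b then e else v w - scale (f b (v w)) e)" for w
  have "f u (v' w) = (if u = w then 1 else 0)" if "u \<in> insert b B" "w \<in> insert b B" for u w
    using that e[OF that(1)] v lin[OF that(1)] insert.hyps
    by (auto simp: v'_def L.linear_scale L.linear_diff)
  then show ?case by blast
qed

text \<open>A basis of \<open>S\<close> is extended to the whole space; \<open>p\<close> kills the
  part in \<open>S\<close> and fixes the rest. With an ideal for \<open>S\<close> this is the source
  of normal forms.\<close>

lemma exists_projection:
  assumes S: "subspace S"
  obtains p where "Vector_Spaces.linear scale scale p" "\<And>x. x - p x \<in> S" "\<And>x. x \<in> S \<Longrightarrow> p x = 0"
proof -
  have pair: "vector_space_pair scale scale"
    by (intro vector_space_pair.intro vector_space_axioms)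
  obtain B where B: "B \<subseteq> S" "independent B" "S \<subseteq> span B"
    using maximal_independent_subset[of S] by blast
  obtain C where C: "B \<subseteq> C" "C \<subseteq> UNIV" "independent C" "UNIV \<subseteq> span C"
    using maximal_independent_subset_extend[of B UNIV] B by blast
  from vector_space_pair.linear_independent_extend[OF pair C(3), of "\<lambda>x. if x \<in> B then 0 else x"]
  obtain p where p: "Vector_Spaces.linear scale scale p" "\<forall>x\<in>C. p x = (if x \<in> B then 0 else x)" by blast
  have add: "p (x + y) = p x + p y" and smult: "p (scale c x) = scale c (p x)" for x y c
    using p(1) by (simp_all add: Vector_Spaces.linear_iff)
  have zero: "p 0 = 0" using smult[of 0 0] by simp
  have "x - p x \<in> S" for x
  proof -
    have "subspace {x. x - p x \<in> S}"
    proof (rule subspaceI)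
      show "0 \<in> {x. x - p x \<in> S}" using S by (simp add: zero subspace_0)
    next
      fix x y assume "x \<in> {x. x - p x \<in> S}" "y \<in> {x. x - p x \<in> S}"
      then have "(x - p x) + (y - p y) \<in> S" using S subspace_add by blast
      then show "x + y \<in> {x. x - p x \<in> S}" by (simp add: add algebra_simps)
    next
      fix c x assume "x \<in> {x. x - p x \<in> S}"
      then have "scale c (x - p x) \<in> S" using S subspace_scale by blast
      then show "scale c x \<in> {x. x - p x \<in> S}" by (simp add: smult scale_right_diff_distrib)
    qed
    moreover have "C \<subseteq> {x. x - p x \<in> S}" using p(2) B(1) subspace_0[OF S] by auto
    ultimately show ?thesis using span_minimal C(4) by blast
  qed
  moreover have "p x = 0" if "x \<in> S" for x
  proof -
    have "subspace {x. p x = 0}" by (rule subspaceI) (simp_all add: zero add smult)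
    moreover have "B \<subseteq> {x. p x = 0}" using p(2) C(1) by auto
    ultimately show ?thesis using span_minimal B(3) that by blast
  qed
  ultimately show thesis using that p(1) by blast
qed

text \<open>By convention \<open>dim\<close> is 0 for a space without a finite basis, so
  monotonicity depends on a finite \<open>T\<close> whose span contains the larger set.\<close>

lemma dim_mono_finite:
  assumes "S \<subseteq> S'" "S' \<subseteq> span T" "finite T"
  shows "dim S \<le> dim S'"
proof -
  obtain B where B: "B \<subseteq> S'" "independent B" "S' \<subseteq> span B" "card B = dim S'"
    using basis_exists by blast
  have "finite B" using independent_span_bound[OF assms(3) B(2)] B(1) assms(2) by blast
  then show ?thesis using dim_le_card[of S B] assms(1) B by auto
qed

lemma dim_strict_mono_finite:
  assumes "S \<subset> S'" "subspace S" "S' \<subseteq> span T" "finite T"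
  shows "dim S < dim S'"
proof -
  obtain B where B: "B \<subseteq> S" "independent B" "S \<subseteq> span B" using maximal_independent_subset by blast
  then have S: "span B = S" using assms(2) span_subspace by blast
  obtain C where C: "B \<subseteq> C" "C \<subseteq> S'" "independent C" "S' \<subseteq> span C"
    using maximal_independent_subset_extend[of B S'] B assms(1) by blast
  have "finite C" using independent_span_bound[OF assms(4) C(3)] C(2) assms(3) by blast
  moreover have "B \<noteq> C" using S C(4) assms(1) by blast
  ultimately have "card B < card C" using C(1) by (simp add: psubset_card_mono psubsetI)
  then show ?thesis
    using basis_card_eq_dim[OF B(1,3,2)] basis_card_eq_dim[OF C(2,4,3)] by simp
qed

lemma card_independent_le_dim:
  assumes "B \<subseteq> S" "independent B" "S \<subseteq> span T" "finite T"
  shows "card B \<le> dim S"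
  using dim_mono_finite[OF assms(1,3,4)] assms(2) by (simp add: dim_eq_card_independent)

text \<open>The right-hand side has the shape in which the record-based \<open>vectorspace\<close>
  defines its dimension.\<close>

lemma dim_eq_Least_card:
  assumes "subspace S" "S \<subseteq> span T" "finite T"
  shows "dim S = (LEAST n. \<exists>B. finite B \<and> card B = n \<and> B \<subseteq> S \<and> span B = S)"
proof -
  obtain B where B: "B \<subseteq> S" "independent B" "S \<subseteq> span B" "card B = dim S"
    using basis_exists by blast
  have "finite B" using independent_span_bound[OF assms(3) B(2)] B(1) assms(2) by blast
  moreover have "span B = S" using B assms(1) span_subspace by blast
  ultimately have "\<exists>B. finite B \<and> card B = dim S \<and> B \<subseteq> S \<and> span B = S" using B by blast
  then show ?thesis
    by (rule Least_equality[symmetric]) (use dim_le_card in blast)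
qed

end

text \<open>Bridge from subspaces of a type to vector spaces given as records. The carrier is the
  image of a subspace \<open>S\<close>, not of the whole type, so that \<open>f\<close> can be made
  injective by taking for \<open>S\<close> a complement of its kernel.\<close>

locale module_image = vector_space scale
  for scale :: "'a::field \<Rightarrow> 'b::ab_group_add \<Rightarrow> 'b" +
  fixes S :: "'b set" and f :: "'b \<Rightarrow> 'c" and V :: "('a, 'c) module"
  assumes S: "subspace S" and image: "carrier V = f ` S"
    and f_zero: "f 0 = \<zero>\<^bsub>V\<^esub>"
    and f_add: "\<And>x y. x \<in> S \<Longrightarrow> y \<in> S \<Longrightarrow> f (x + y) = f x \<oplus>\<^bsub>V\<^esub> f y"
    and f_scale: "\<And>c x. x \<in> S \<Longrightarrow> f (scale c x) = c \<odot>\<^bsub>V\<^esub> f x"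
begin

lemma vectorspace: "vectorspace class_ring V"
proof (rule vs_criteria)
  show "field (class_ring :: 'a ring)" by (rule class_field)
  show "\<zero>\<^bsub>V\<^esub> \<in> carrier V" using image f_zero subspace_0[OF S] by (metis imageI)
  show "\<forall>v\<in>carrier V. \<exists>w\<in>carrier V. v \<oplus>\<^bsub>V\<^esub> w = \<zero>\<^bsub>V\<^esub>"
  proof
    fix v assume "v \<in> carrier V"
    then obtain x where x: "x \<in> S" "v = f x" using image by blast
    then have "v \<oplus>\<^bsub>V\<^esub> f (- x) = \<zero>\<^bsub>V\<^esub>" using f_add[of x "- x"] f_zero subspace_neg[OF S] by simp
    then show "\<exists>w\<in>carrier V. v \<oplus>\<^bsub>V\<^esub> w = \<zero>\<^bsub>V\<^esub>" using x image subspace_neg[OF S] by blast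
  qed
qed (auto simp: image f_zero[symmetric] f_add[symmetric] f_scale[symmetric] scale_left_distrib
    scale_right_distrib ac_simps subspace_add[OF S] subspace_scale[OF S] subspace_0[OF S] intro!: imageI)

sublocale V: vectorspace "class_ring :: 'a ring" V
  by (rule vectorspace)

lemma span_image:
  assumes "B \<subseteq> S"
  shows "V.span (f ` B) = f ` span B"
proof
  have B: "span B \<subseteq> S" using assms S span_minimal by blast
  show "V.span (f ` B) \<subseteq> f ` span B"
  proof (rule V.span_is_subset)
    show "f ` B \<subseteq> f ` span B" using span_superset by blast
    show "submodule class_ring (f ` span B) V"
    proof
      fix v w assume "v \<in> f ` span B" "w \<in> f ` span B"
      then obtain x y where "x \<in> span B" "y \<in> span B" "v = f x" "w = f y" by blast
      then show "v \<oplus>\<^bsub>V\<^esub> w \<in> f ` span B"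
        using f_add[of x y] B span_add[of x B y] by (metis imageI subsetD)
    next
      fix c v assume "v \<in> f ` span B"
      then obtain x where "x \<in> span B" "v = f x" by blast
      then show "c \<odot>\<^bsub>V\<^esub> v \<in> f ` span B"
        using f_scale[of x c] B span_scale[of x B c] by (metis imageI subsetD)
    next
      show "\<zero>\<^bsub>V\<^esub> \<in> f ` span B" using f_zero span_zero by (metis imageI)
    qed (use image B in blast)
  qed
  have "f ` B \<subseteq> carrier V" using assms image by blast
  then have sub: "submodule class_ring (V.span (f ` B)) V" by (rule V.span_is_submodule)
  have "span B \<subseteq> {x \<in> S. f x \<in> V.span (f ` B)}"
  proof (rule span_minimal)
    show "B \<subseteq> {x \<in> S. f x \<in> V.span (f ` B)}"
      using assms V.in_own_span[OF \<open>f ` B \<subseteq> carrier V\<close>] by blast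
    show "subspace {x \<in> S. f x \<in> V.span (f ` B)}"
      using submodule.m_closed[OF sub] submodule.smult_closed[OF sub] submodule.zero_closed[OF sub]
      by (intro subspaceI)
        (auto simp: f_add f_scale f_zero subspace_0[OF S] subspace_add[OF S] subspace_scale[OF S])
  qed
  then show "f ` span B \<subseteq> V.span (f ` B)" by blast
qed

lemma ex_spanning_iff:
  assumes inj: "inj_on f S"
  shows "(\<exists>A. finite A \<and> card A = n \<and> A \<subseteq> carrier V \<and> V.span A = carrier V) \<longleftrightarrow>
    (\<exists>B. finite B \<and> card B = n \<and> B \<subseteq> S \<and> span B = S)"
proof
  assume "\<exists>A. finite A \<and> card A = n \<and> A \<subseteq> carrier V \<and> V.span A = carrier V"
  then obtain A where A: "finite A" "card A = n" "A \<subseteq> f ` S" "V.span A = f ` S"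
    using image by metis
  then obtain B where B: "B \<subseteq> S" "A = f ` B" by (metis subset_imageE)
  then have "inj_on f B" using inj inj_on_subset by blast
  then have "finite B" "card B = n" using A B by (auto simp: finite_image_iff card_image)
  moreover have "span B = S"
  proof -
    have "f ` span B = f ` S" using span_image[OF B(1)] A(4) B(2) by simp
    moreover have "span B \<subseteq> S" using B(1) S span_minimal by blast
    ultimately show ?thesis using inj by (simp add: inj_on_image_eq_iff)
  qed
  ultimately show "\<exists>B. finite B \<and> card B = n \<and> B \<subseteq> S \<and> span B = S" using B(1) by blast
next
  assume "\<exists>B. finite B \<and> card B = n \<and> B \<subseteq> S \<and> span B = S"
  then obtain B where B: "finite B" "card B = n" "B \<subseteq> S" "span B = S" by blast
  moreover have "card (f ` B) = n" using B inj by (metis card_image inj_on_subset)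
  ultimately show "\<exists>A. finite A \<and> card A = n \<and> A \<subseteq> carrier V \<and> V.span A = carrier V"
    using image span_image[OF B(3)] by (intro exI[of _ "f ` B"]) auto
qed

text \<open>The right-hand side mentions neither \<open>f\<close> nor \<open>V\<close>: two records
  parametrised injectively by the same \<open>S\<close> have equal dimension, without a finite
  spanning set being exhibited.\<close>

lemma dim_eq_Least:
  assumes "inj_on f S"
  shows "V.dim = (LEAST n. \<exists>B. finite B \<and> card B = n \<and> B \<subseteq> S \<and> span B = S)"
  unfolding V.dim_def ex_spanning_iff[OF assms] ..

lemma fin_dim_imp_spanned:
  assumes "inj_on f S" "V.fin_dim"
  obtains B where "finite B" "span B = S"
  using assms ex_spanning_iff[OF assms(1)] unfolding V.fin_dim_def by metis

lemma dim_eq: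
  assumes "inj_on f S" "S \<subseteq> span T" "finite T"
  shows "V.dim = dim S"
  using dim_eq_Least[OF assms(1)] dim_eq_Least_card[OF S assms(2,3)] by simp

end

section \<open>Ideals of a commutative ring and their cosets\<close>

lemma ideal_class_ring_iff:
  fixes J :: "'a::comm_ring_1 set"
  shows "ideal J class_ring \<longleftrightarrow>
    0 \<in> J \<and> (\<forall>x\<in>J. \<forall>y\<in>J. x + y \<in> J) \<and> (\<forall>x\<in>J. \<forall>r. r * x \<in> J)"
proof
  assume "ideal J class_ring"
  then interpret ideal J "class_ring :: 'a ring" .
  show "0 \<in> J \<and> (\<forall>x\<in>J. \<forall>y\<in>J. x + y \<in> J) \<and> (\<forall>x\<in>J. \<forall>r. r * x \<in> J)"
    using additive_subgroup.zero_closed[OF is_additive_subgroup]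
      additive_subgroup.a_closed[OF is_additive_subgroup] I_l_closed by simp
next
  assume *: "0 \<in> J \<and> (\<forall>x\<in>J. \<forall>y\<in>J. x + y \<in> J) \<and> (\<forall>x\<in>J. \<forall>r. r * x \<in> J)"
  then have minus: "- x \<in> J" if "x \<in> J" for x using that by (metis mult_minus1)
  show "ideal J class_ring"
  proof (rule idealI)
    show "ring (class_ring :: 'a ring)" by (rule class_ring.ring_axioms)
    show "subgroup J (add_monoid (class_ring :: 'a ring))"
    proof (rule subgroup.intro)
      show "inv\<^bsub>add_monoid (class_ring :: 'a ring)\<^esub> x \<in> J" if "x \<in> J" for x
        using minus[OF that] class_ring_simps by (metis a_inv_def)
    qed (use * in auto)
  qed (use * in \<open>auto simp: mult.commute\<close>)
qed

lemma ideal_class_ringI: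
  fixes J :: "'a::comm_ring_1 set"
  assumes "0 \<in> J" "\<And>x y. x \<in> J \<Longrightarrow> y \<in> J \<Longrightarrow> x + y \<in> J" "\<And>x r. x \<in> J \<Longrightarrow> r * x \<in> J"
  shows "ideal J class_ring"
  using assms by (simp add: ideal_class_ring_iff)

context
  fixes J :: "'a::comm_ring_1 set"
  assumes J: "ideal J class_ring"
begin

lemma ideal_zero: "0 \<in> J"
  and ideal_add: "x \<in> J \<Longrightarrow> y \<in> J \<Longrightarrow> x + y \<in> J"
  and ideal_mult: "x \<in> J \<Longrightarrow> r * x \<in> J"
  using J by (auto simp: ideal_class_ring_iff)

lemma ideal_mult_right: "x \<in> J \<Longrightarrow> x * r \<in> J"
  using ideal_mult[of x r] by (simp add: mult.commute)

lemma ideal_minus: "x \<in> J \<Longrightarrow> - x \<in> J"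
  using ideal_mult[of x "-1"] by simp

lemma ideal_diff: "x \<in> J \<Longrightarrow> y \<in> J \<Longrightarrow> x - y \<in> J"
  using ideal_add[of x "- y"] ideal_minus by simp

lemma a_r_coset_class_ring_eq_iff:
  "a_r_coset class_ring J p = a_r_coset class_ring J q \<longleftrightarrow> p - q \<in> J"
proof -
  interpret ideal J "class_ring :: 'a ring" by (rule J)
  have eq: "a_r_coset class_ring J x = {h + x |h. h \<in> J}" for x
    by (auto simp: a_r_coset_def')
  show ?thesis
  proof
    assume "a_r_coset class_ring J p = a_r_coset class_ring J q"
    moreover have "p \<in> a_r_coset class_ring J p" unfolding eq using ideal_zero by force
    ultimately show "p - q \<in> J" unfolding eq by auto
  next
    assume *: "p - q \<in> J"
    have "h + p = (h + (p - q)) + q" "h + q = (h - (p - q)) + p" for h by auto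
    with * show "a_r_coset class_ring J p = a_r_coset class_ring J q"
      unfolding eq using ideal_add ideal_diff by blast
  qed
qed

end

lemma ideal_add_multiples:
  fixes J :: "'a::comm_ring_1 set"
  assumes J: "ideal J class_ring"
  shows "ideal {x + r * a | x r. x \<in> J} class_ring"
proof -
  have "ideal (J <+>\<^bsub>class_ring\<^esub> PIdl\<^bsub>class_ring\<^esub> a) class_ring"
    by (intro ring.add_ideals cring.cgenideal_ideal class_ring.ring_axioms class_cring.cring_axioms J)
      simp
  moreover have "J <+>\<^bsub>class_ring\<^esub> PIdl\<^bsub>class_ring\<^esub> a = {x + r * a | x r. x \<in> J}"
    by (auto simp: set_add_def' cgenideal_def)
  ultimately show ?thesis by simp
qed

section \<open>The algebra \<open>P/I\<close>\<close>

definition scale_poly :: "'k::field \<Rightarrow> ('n, 'k) mpoly \<Rightarrow> ('n, 'k) mpoly"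
  where "scale_poly c p = Poly_Mapping.single 0 c * p"

global_interpretation P: vector_space "scale_poly :: 'k::field \<Rightarrow> ('n, 'k) mpoly \<Rightarrow> ('n, 'k) mpoly"
  by unfold_locales
    (simp_all add: scale_poly_def algebra_simps single_add mult_single flip: mult.assoc)

lemma ideal_subspace: "ideal J class_ring \<Longrightarrow> P.subspace J"
  by (rule P.subspaceI) (auto simp: scale_poly_def ideal_zero ideal_add ideal_mult)

lemma residue_class_eq_iff:
  "ideal I class_ring \<Longrightarrow> residue_class I p = residue_class I q \<longleftrightarrow> p - q \<in> I"
  unfolding residue_class_def by (rule a_r_coset_class_ring_eq_iff)

context
  fixes I :: "('n::finite, 'k::field) mpoly set"
  assumes I: "ideal I class_ring"
begin

interpretation ideal I "class_ring :: ('n, 'k) mpoly ring" by (rule I)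

lemma carrier_quot_alg: "carrier (quot_alg I) = range (residue_class I)"
  by (auto simp: quot_alg_def ring.defs FactRing_def A_RCOSETS_def' residue_class_def)

lemma zero_quot_alg: "\<zero>\<^bsub>quot_alg I\<^esub> = residue_class I 0"
proof -
  have "\<zero>\<^bsub>quot_alg I\<^esub> = I" by (simp add: quot_alg_def ring.defs FactRing_def)
  also have "\<dots> = residue_class I 0" by (auto simp: residue_class_def a_r_coset_def')
  finally show ?thesis .
qed

lemma one_quot_alg: "\<one>\<^bsub>quot_alg I\<^esub> = residue_class I 1"
  by (simp add: quot_alg_def ring.defs FactRing_def residue_class_def)

lemma add_quot_alg: "residue_class I p \<oplus>\<^bsub>quot_alg I\<^esub> residue_class I q = residue_class I (p + q)"
  using a_rcos_sum[of p q] by (simp add: quot_alg_def ring.defs FactRing_def residue_class_def)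

lemma mult_quot_alg: "residue_class I p \<otimes>\<^bsub>quot_alg I\<^esub> residue_class I q = residue_class I (p * q)"
  using rcoset_mult_add[of p q] by (simp add: quot_alg_def ring.defs FactRing_def residue_class_def)

lemma smult_quot_alg: "c \<odot>\<^bsub>quot_alg I\<^esub> residue_class I p = residue_class I (scale_poly c p)"
  using rcoset_mult_add[of "Poly_Mapping.single 0 c" p]
  by (simp add: quot_alg_def ring.defs FactRing_def residue_class_def scale_poly_def)

lemmas quot_alg_simps =
  carrier_quot_alg zero_quot_alg one_quot_alg add_quot_alg mult_quot_alg smult_quot_alg

lemma cring_quot_alg: "cring (quot_alg I)"
proof (intro cringI abelian_groupI comm_monoidI)
  fix x assume "x \<in> carrier (quot_alg I)"
  then obtain p where "x = residue_class I p" by (auto simp: quot_alg_simps)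
  then have "residue_class I (- p) \<oplus>\<^bsub>quot_alg I\<^esub> x = \<zero>\<^bsub>quot_alg I\<^esub>"
    by (simp add: quot_alg_simps)
  then show "\<exists>y\<in>carrier (quot_alg I). y \<oplus>\<^bsub>quot_alg I\<^esub> x = \<zero>\<^bsub>quot_alg I\<^esub>"
    by (auto simp: carrier_quot_alg)
qed (auto simp: quot_alg_simps algebra_simps)

text \<open>The map \<open>g\<close> is the identity when cosets are represented in a complement of
  the ideal, and multiplication by a fixed polynomial when a minimal overideal is parametrised by
  multiples of one element.\<close>

lemma module_image_quot_alg:
  assumes S: "P.subspace S" and g: "Vector_Spaces.linear scale_poly scale_poly g"
    and W: "residue_class I ` W = residue_class I ` g ` S"
  shows "module_image scale_poly S (\<lambda>p. residue_class I (g p))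
    ((quot_alg I)\<lparr>carrier := residue_class I ` W\<rparr>)"
proof -
  interpret g: Vector_Spaces.linear scale_poly scale_poly g by (rule g)
  show ?thesis
    by unfold_locales
      (use S W in \<open>simp_all add: quot_alg_simps g.add g.scale g.zero image_image\<close>)
qed

end

section \<open>The degree filtration\<close>

lemma filt_P_iff: "f \<in> filt_P i \<longleftrightarrow> (\<forall>m\<in>Poly_Mapping.keys f. int (monom_deg m) \<le> i)"
proof (cases "f = 0")
  case False
  then have "finite (monom_deg ` Poly_Mapping.keys f)" "monom_deg ` Poly_Mapping.keys f \<noteq> {}" by auto
  then have "int (total_deg f) \<le> i \<longleftrightarrow> (\<forall>m\<in>Poly_Mapping.keys f. int (monom_deg m) \<le> i)"
    unfolding total_deg_def using Max_in[of "monom_deg ` Poly_Mapping.keys f"]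
    by (metis (no_types, lifting) Max_ge dual_order.trans image_iff of_nat_le_iff)
  with False show ?thesis by (simp add: filt_P_def)
qed (simp add: filt_P_def)

lemma filt_P_subspace: "P.subspace (filt_P i :: ('n::finite, 'k::field) mpoly set)"
proof (rule P.subspaceI)
  show "x + y \<in> filt_P i" if "x \<in> filt_P i" "y \<in> filt_P i" for x y :: "('n, 'k) mpoly"
    using that Poly_Mapping.keys_add[of x y] by (auto simp: filt_P_iff)
  show "scale_poly c x \<in> filt_P i" if "x \<in> filt_P i" for c and x :: "('n, 'k) mpoly"
    using that keys_mult[of "Poly_Mapping.single 0 c" x]
    by (fastforce simp: filt_P_iff scale_poly_def split: if_splits)
qed (simp add: filt_P_def)

lemma monom_deg_add: "monom_deg (m + m') = monom_deg m + monom_deg m'"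
  by (simp add: monom_deg_def lookup_add sum.distrib)

lemma filt_P_mult: "f \<in> filt_P i \<Longrightarrow> g \<in> filt_P j \<Longrightarrow> f * g \<in> filt_P (i + j)"
  using keys_mult[of f g] by (fastforce simp: filt_P_iff monom_deg_add)

lemma filt_P_mono: "i \<le> j \<Longrightarrow> filt_P i \<subseteq> filt_P j"
  by (auto simp: filt_P_def)

lemma filt_P_exhaustive: "\<exists>i. f \<in> filt_P i"
  by (auto simp: filt_P_def)

lemma filt_P_negative: "f \<in> filt_P i \<Longrightarrow> i < 0 \<Longrightarrow> f = 0"
  by (auto simp: filt_P_def)

text \<open>The values of \<open>nf\<close> form a linear complement of \<open>I\<close> and stand
  for the elements of \<open>R\<close>. Any complement serves; no monomial order is
  involved.\<close>

locale finite_codim_ideal =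
  fixes I :: "('n::finite, 'k::field) mpoly set"
    and nf :: "('n, 'k) mpoly \<Rightarrow> ('n, 'k) mpoly"
    and T :: "('n, 'k) mpoly set"
  assumes I: "ideal I class_ring"
    and linear_nf: "Vector_Spaces.linear scale_poly scale_poly nf"
    and diff_nf: "p - nf p \<in> I"
    and nf_eq_zero: "p \<in> I \<Longrightarrow> nf p = 0"
    and finite_T: "finite T"
    and range_nf: "range nf \<subseteq> P.span T"
begin

sublocale nf: Vector_Spaces.linear scale_poly scale_poly nf
  by (rule linear_nf)

lemma nf_eq_iff: "nf p = nf q \<longleftrightarrow> p - q \<in> I"
proof
  assume "nf p = nf q"
  then have "p - q = (p - nf p) - (q - nf q)" by simp
  then show "p - q \<in> I" using diff_nf ideal_diff[OF I] by metis
qed (use nf_eq_zero[of "p - q"] in \<open>simp add: nf.diff\<close>)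

lemma nf_nf: "nf (nf p) = nf p"
  using nf_eq_iff[of "nf p" p] diff_nf[of p] ideal_minus[OF I, of "p - nf p"] by simp

lemma residue_class_nf: "residue_class I (nf p) = residue_class I p"
  using nf_nf by (simp add: residue_class_eq_iff[OF I] flip: nf_eq_iff)

lemma nf_image_span: "nf ` W \<subseteq> P.span T"
  using range_nf by blast

lemma sub_dim_eq:
  assumes "P.subspace W"
  shows "sub_dim I (residue_class I ` W) = P.dim (nf ` W)"
proof -
  have "residue_class I ` W = residue_class I ` (\<lambda>x. x) ` nf ` W"
    by (simp add: image_image residue_class_nf)
  from module_image_quot_alg[OF I nf.subspace_image[OF assms] P.linear_ident this]
  interpret M: module_image scale_poly "nf ` W" "residue_class I"
    "(quot_alg I)\<lparr>carrier := residue_class I ` W\<rparr>" by simp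
  have "inj_on (residue_class I) (nf ` W)"
    by (auto simp: inj_on_def residue_class_eq_iff[OF I] nf_nf simp flip: nf_eq_iff)
  from M.dim_eq[OF this nf_image_span finite_T] show ?thesis by (simp add: sub_dim_def)
qed

lemma dim_R_eq: "dim_R I = P.dim (range nf)"
proof -
  have "(quot_alg I)\<lparr>carrier := range (residue_class I)\<rparr> = quot_alg I"
    by (simp add: carrier_quot_alg[OF I, symmetric])
  then show ?thesis using sub_dim_eq[OF P.subspace_UNIV] by (simp add: sub_dim_def dim_R_def)
qed

lemma HF_eq: "HF I i = P.dim (nf ` filt_P i)"
  by (simp add: HF_def filt_R_def sub_dim_eq filt_P_subspace)

text \<open>Ranks the ideals above \<open>I\<close> by a natural number, which gives both the
  maximal and the minimal condition for them.\<close>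

lemma dim_nf_strict_mono:
  assumes "P.subspace J" "P.subspace J'" "I \<subseteq> J" "J \<subset> J'"
  shows "P.dim (nf ` J) < P.dim (nf ` J')"
proof (rule P.dim_strict_mono_finite[OF _ _ nf_image_span finite_T])
  obtain p where p: "p \<in> J'" "p \<notin> J" using assms(4) by blast
  have "nf p \<notin> nf ` J"
  proof
    assume "nf p \<in> nf ` J"
    then obtain q where "q \<in> J" "p - q \<in> J" using nf_eq_iff assms(3) by blast
    then have "p - q + q \<in> J" using assms(1) P.subspace_add by blast
    with p(2) show False by simp
  qed
  then show "nf ` J \<subset> nf ` J'" using p(1) assms(4) by blast
  show "P.subspace (nf ` J)" using assms(1) by (rule nf.subspace_image)
qed

lemma exists_maximal_ideal:
  assumes "\<F> \<noteq> {}" "\<And>J. J \<in> \<F> \<Longrightarrow> ideal J class_ring \<and> I \<subseteq> J"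
  shows "\<exists>J\<in>\<F>. \<forall>J'\<in>\<F>. J \<subseteq> J' \<longrightarrow> J' = J"
proof -
  obtain J0 where J0: "J0 \<in> \<F>" using assms(1) by blast
  have bound: "\<forall>J. J \<in> \<F> \<longrightarrow> P.dim (nf ` J) < Suc (card T)"
    using P.dim_le_card[OF nf_image_span finite_T] by (simp add: less_Suc_eq_le)
  obtain J where J: "J \<in> \<F>" "\<forall>J'. J' \<in> \<F> \<longrightarrow> P.dim (nf ` J') \<le> P.dim (nf ` J)"
    using ex_has_greatest_nat[of "\<lambda>J. J \<in> \<F>" J0 "\<lambda>J. P.dim (nf ` J)", OF J0 bound]
    by (elim exE conjE)
  have "J' = J" if "J' \<in> \<F>" "J \<subseteq> J'" for J'
  proof (rule ccontr)
    assume "J' \<noteq> J"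
    then have "P.dim (nf ` J) < P.dim (nf ` J')"
      using that J(1) assms(2) by (intro dim_nf_strict_mono ideal_subspace) auto
    with J(2) that(1) show False by (simp add: leD)
  qed
  with J(1) show ?thesis by blast
qed

lemma exists_minimal_ideal:
  assumes "J0 \<in> \<F>" "\<And>J. J \<in> \<F> \<Longrightarrow> ideal J class_ring \<and> I \<subseteq> J"
  shows "\<exists>J\<in>\<F>. \<forall>J'\<in>\<F>. J' \<subseteq> J \<longrightarrow> J' = J"
proof -
  obtain J where J: "J \<in> \<F>" "\<forall>J'. J' \<in> \<F> \<longrightarrow> P.dim (nf ` J) \<le> P.dim (nf ` J')"
    using ex_has_least_nat[of "\<lambda>J. J \<in> \<F>" J0 "\<lambda>J. P.dim (nf ` J)", OF assms(1)]
    by (elim exE conjE)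
  have "J' = J" if "J' \<in> \<F>" "J' \<subseteq> J" for J'
  proof (rule ccontr)
    assume "J' \<noteq> J"
    then have "P.dim (nf ` J') < P.dim (nf ` J)"
      using that J(1) assms(2) by (intro dim_nf_strict_mono ideal_subspace) auto
    with J(2) that(1) show False by (simp add: leD)
  qed
  with J(1) show ?thesis by blast
qed

text \<open>If \<open>\<psi>\<close> is nondegenerate, then the functionals \<open>\<psi>(u \<cdot>)\<close> for \<open>u\<close> in a basis of \<open>U\<close> have a dual
  family; it is linearly independent modulo the subspace \<open>W\<close>, on which all these functionals vanish.\<close>

lemma dim_add_le_of_orthogonal:
  assumes lin: "Vector_Spaces.linear scale_poly (*) \<psi>"
    and I_zero: "\<And>p. p \<in> I \<Longrightarrow> \<psi> p = 0"
    and nondegenerate: "\<And>f. (\<And>g. \<psi> (f * g) = 0) \<Longrightarrow> f \<in> I"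
    and orth: "\<And>u w. u \<in> U \<Longrightarrow> w \<in> W \<Longrightarrow> \<psi> (u * w) = 0"
  shows "P.dim (nf ` U) + P.dim (nf ` W) \<le> P.dim (range nf)"
proof -
  interpret \<psi>: Vector_Spaces.linear scale_poly "(*)" \<psi> by (rule lin)
  have \<psi>_eqI: "\<psi> p = \<psi> q" if "p - q \<in> I" for p q
    using I_zero[OF that] by (simp add: \<psi>.diff)
  have \<psi>_nf: "\<psi> (p * nf q) = \<psi> (p * q)" for p q
    by (rule \<psi>_eqI) (metis I diff_nf ideal_minus ideal_mult minus_diff_eq right_diff_distrib)
  obtain A where A: "A \<subseteq> nf ` U" "P.independent A" "card A = P.dim (nf ` U)"
    using P.basis_exists[of "nf ` U"] by metis
  obtain B where B: "B \<subseteq> nf ` W" "P.independent B" "card B = P.dim (nf ` W)"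
    using P.basis_exists[of "nf ` W"] by metis
  have fin: "finite A" "finite B"
    using P.independent_span_bound[OF finite_T A(2)] P.independent_span_bound[OF finite_T B(2)]
      A(1) B(1) range_nf by (meson image_mono subset_UNIV subset_trans)+
  have scale_mult: "scale_poly a p * q = scale_poly a (p * q)"
    and mult_scale: "p * scale_poly a q = scale_poly a (p * q)" for a p q
    by (simp_all add: scale_poly_def mult.assoc mult.left_commute)
  have lin_mult: "Vector_Spaces.linear scale_poly (*) (\<lambda>g. \<psi> (u * g))" for u
    using lin by (simp add: Vector_Spaces.linear_iff distrib_left mult_scale)
  have indep: "\<forall>u\<in>A. c u = 0" if c: "\<And>g. (\<Sum>u\<in>A. c u * \<psi> (u * g)) = 0" for c
  proof -
    \<comment> \<open>A relation among the functionals says that the single element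
      \<open>?f\<close> pairs to zero with everything, hence lies in \<open>I\<close>; being a
      normal form, it is 0.\<close>
    let ?f = "\<Sum>u\<in>A. scale_poly (c u) u"
    have "\<psi> (?f * g) = (\<Sum>u\<in>A. c u * \<psi> (u * g))" for g
      by (simp add: sum_distrib_right \<psi>.sum \<psi>.scale scale_mult)
    with c have "\<psi> (?f * g) = 0" for g by simp
    then have "?f \<in> I" by (rule nondegenerate)
    then have "nf ?f = 0" by (rule nf_eq_zero)
    moreover have "nf ?f = ?f"
      using A(1) by (auto simp: nf.sum nf.scale nf_nf intro!: sum.cong)
    ultimately have "?f = 0" by simp
    then show ?thesis using P.independentD[OF A(2) fin(1) subset_refl] by blast
  qed
  from P.exists_dual_family[OF fin(1), of "\<lambda>u g. \<psi> (u * g)", OF lin_mult indep]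
  obtain v where v: "\<forall>u\<in>A. \<forall>w\<in>A. \<psi> (u * v w) = (if u = w then 1 else 0)" by auto
  \<comment> \<open>Passing to normal forms changes no value of the pairing and places the dual
    family in \<open>range nf\<close>, where dimensions are counted.\<close>
  define v' where "v' w = nf (v w)" for w
  have v': "\<psi> (u * v' w) = (if u = w then 1 else 0)" if "u \<in> A" "w \<in> A" for u w
    using v that by (simp add: v'_def \<psi>_nf)
  have AB: "\<psi> (u * b) = 0" if "u \<in> A" "b \<in> B" for u b
  proof -
    from that A(1) B(1) obtain x y where "x \<in> U" "u = nf x" "y \<in> W" "b = nf y" by fast
    then show ?thesis using \<psi>_nf orth by (metis mult.commute)
  qed
  have inj: "inj_on v' A"
  proof (rule inj_onI)
    fix u w assume "u \<in> A" "w \<in> A" "v' u = v' w"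
    then show "u = w" using v'[of u u] v'[of u w] by (simp split: if_splits)
  qed
  have disj: "v' ` A \<inter> B = {}" using v' AB by fastforce
  have "P.independent (v' ` A \<union> B)"
  proof (rule P.independent_if_scalars_zero)
    show "finite (v' ` A \<union> B)" using fin by simp
  next
    fix c x assume sum0: "(\<Sum>x\<in>v' ` A \<union> B. scale_poly (c x) x) = 0" and x: "x \<in> v' ` A \<union> B"
    have split: "(\<Sum>w\<in>A. scale_poly (c (v' w)) (v' w)) + (\<Sum>b\<in>B. scale_poly (c b) b) = 0"
      using sum0 by (simp add: sum.union_disjoint fin disj sum.reindex[OF inj])
    have cA: "c (v' u) = 0" if "u \<in> A" for u
    proof -
      have "0 = \<psi> (u * ((\<Sum>w\<in>A. scale_poly (c (v' w)) (v' w)) + (\<Sum>b\<in>B. scale_poly (c b) b)))"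
        by (simp add: split \<psi>.zero)
      also have "\<dots> = (\<Sum>w\<in>A. c (v' w) * \<psi> (u * v' w)) + (\<Sum>b\<in>B. c b * \<psi> (u * b))"
        by (simp add: distrib_left sum_distrib_left mult_scale \<psi>.add \<psi>.sum \<psi>.scale)
      also have "(\<Sum>b\<in>B. c b * \<psi> (u * b)) = 0" using AB that by simp
      also have "(\<Sum>w\<in>A. c (v' w) * \<psi> (u * v' w)) = (\<Sum>w\<in>A. if u = w then c (v' w) else 0)"
        using v' that by (intro sum.cong) auto
      finally show ?thesis using that fin(1) by simp
    qed
    then have "(\<Sum>b\<in>B. scale_poly (c b) b) = 0" using split by simp
    then have "\<forall>b\<in>B. c b = 0" using P.independentD[OF B(2) fin(2) subset_refl] by blast
    with cA x show "c x = 0" by blast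
  qed
  moreover have "v' ` A \<union> B \<subseteq> range nf" using B(1) by (auto simp: v'_def)
  ultimately have "card (v' ` A \<union> B) \<le> P.dim (range nf)"
    by (intro P.card_independent_le_dim[OF _ _ range_nf finite_T])
  then show ?thesis
    using A(3) B(3) by (simp add: card_Un_disjoint fin disj card_image[OF inj])
qed

text \<open>Degrees add under multiplication, so \<open>filt_P i\<close> and
  \<open>filt_P (d - i)\<close> are orthogonal. Both claims of the theorem end here and differ only
  in the origin of \<psi>.\<close>

lemma HF_add_le:
  assumes "Vector_Spaces.linear scale_poly (*) \<psi>"
    and "\<And>p. p \<in> I \<Longrightarrow> \<psi> p = 0"
    and "\<And>f. (\<And>g. \<psi> (f * g) = 0) \<Longrightarrow> f \<in> I"
    and "\<And>p. p \<in> filt_P d \<Longrightarrow> \<psi> p = 0"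
  shows "HF I i + HF I (d - i) \<le> dim_R I"
  unfolding HF_eq dim_R_eq
proof (rule dim_add_le_of_orthogonal[OF assms(1-3)])
  show "\<psi> (u * w) = 0" if "u \<in> filt_P i" "w \<in> filt_P (d - i)" for u w
    using filt_P_mult[OF that] assms(4) by simp
qed

end

text \<open>Residue classes are injective on a complement of \<open>I\<close>, so a finite spanning
  set of the record \<open>quot_alg I\<close> can be pulled back to polynomials.\<close>

lemma finite_codim_ideal_exists:
  fixes I :: "('n::finite, 'k::field) mpoly set"
  assumes I: "ideal I class_ring" and fin: "vectorspace.fin_dim (class_ring :: 'k ring) (quot_alg I)"
  obtains nf T where "finite_codim_ideal I nf T"
proof -
  obtain nf where nf: "Vector_Spaces.linear scale_poly scale_poly nf" "\<And>x. x - nf x \<in> I"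
      "\<And>x. x \<in> I \<Longrightarrow> nf x = 0"
    using P.exists_projection[OF ideal_subspace[OF I]] by blast
  interpret nf: Vector_Spaces.linear scale_poly scale_poly nf by (rule nf(1))
  have res: "residue_class I x = residue_class I (nf x)" for x
    using nf(2) by (simp add: residue_class_eq_iff[OF I])
  have sub: "P.subspace (range nf)" using nf.subspace_image[OF P.subspace_UNIV] .
  have "residue_class I ` UNIV = residue_class I ` (\<lambda>x. x) ` range nf"
    by (simp add: image_image res[symmetric])
  from module_image_quot_alg[OF I sub P.linear_ident this]
  interpret M: module_image scale_poly "range nf" "residue_class I" "quot_alg I"
    by (simp add: carrier_quot_alg[OF I, symmetric])
  have "inj_on (residue_class I) (range nf)"
  proof (rule inj_onI)
    fix x y assume "x \<in> range nf" "y \<in> range nf" "residue_class I x = residue_class I y"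
    then obtain p q where "x = nf p" "y = nf q" "p - q \<in> I"
      using res residue_class_eq_iff[OF I] by (metis imageE)
    then show "x = y" using nf(3)[of "p - q"] by (simp add: nf.diff)
  qed
  from M.fin_dim_imp_spanned[OF this fin] obtain T where "finite T" "P.span T = range nf" by blast
  with I nf have "finite_codim_ideal I nf T"
    by (intro finite_codim_ideal.intro) auto
  then show thesis by (rule that)
qed

section \<open>Primary decomposition\<close>

lemma primary_ideal_class_ring_iff:
  fixes Q :: "'a::comm_ring_1 set"
  shows "primary_ideal Q class_ring \<longleftrightarrow> ideal Q class_ring \<and> Q \<noteq> UNIV \<and>
    (\<forall>a b. a * b \<in> Q \<longrightarrow> a \<in> Q \<or> (\<exists>k. b ^ k \<in> Q))"
  by (simp add: primary_ideal_def class_ring_simps)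

lemma radical_class_ring: "radical class_ring (Q :: 'a::comm_ring_1 set) = {a. \<exists>k. a ^ k \<in> Q}"
  by (simp add: Defs.radical_def class_ring_simps)

text \<open>Allows components with equal radicals to be merged.\<close>

lemma primary_ideal_Int:
  fixes Q Q' :: "'a::comm_ring_1 set"
  assumes Q: "primary_ideal Q class_ring" and Q': "primary_ideal Q' class_ring"
    and rad: "radical class_ring Q = radical class_ring Q'"
  shows "primary_ideal (Q \<inter> Q') class_ring"
proof -
  have ideals: "ideal Q class_ring" "ideal Q' class_ring"
    using Q Q' by (auto simp: primary_ideal_class_ring_iff)
  have "\<exists>k. b ^ k \<in> Q \<inter> Q'" if "a * b \<in> Q \<inter> Q'" "a \<notin> Q \<inter> Q'" for a b
  proof -
    have "b \<in> radical class_ring Q \<or> b \<in> radical class_ring Q'"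
      using that Q Q' unfolding primary_ideal_class_ring_iff radical_class_ring by blast
    with rad have "b \<in> radical class_ring Q" "b \<in> radical class_ring Q'" by auto
    then obtain k l where "b ^ k \<in> Q" "b ^ l \<in> Q'" unfolding radical_class_ring by blast
    then have "b ^ (k + l) \<in> Q \<inter> Q'"
      using ideals by (simp add: power_add ideal_mult ideal_mult_right)
    then show ?thesis ..
  qed
  moreover have "ideal (Q \<inter> Q') class_ring"
    using ideals by (intro ideal_class_ringI) (auto simp: ideal_zero ideal_add ideal_mult)
  ultimately show ?thesis
    using Q unfolding primary_ideal_class_ring_iff by blast
qed

text \<open>A maximal condition for the ideals above \<open>I\<close> takes the place of
  Noetherianity of the ring; for finite codimension it is supplied by
  \<open>exists_maximal_ideal\<close>.\<close>

context
  fixes I :: "'a::comm_ring_1 set"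
  assumes acc: "\<And>\<F>. \<F> \<noteq> {} \<Longrightarrow> (\<And>J. J \<in> \<F> \<Longrightarrow> ideal J class_ring \<and> I \<subseteq> J) \<Longrightarrow>
    \<exists>J\<in>\<F>. \<forall>J'\<in>\<F>. J \<subseteq> J' \<longrightarrow> J' = J"
begin

text \<open>A maximal counterexample \<open>J\<close> is not primary, say \<open>a b \<in> J\<close>; for large \<open>n\<close> it is the intersection of
  the larger ideals \<open>J : b\<^sup>n\<close> and \<open>J + (b\<^sup>n)\<close>.\<close>

lemma ideal_eq_Inter_primary:
  assumes "ideal J class_ring" "I \<subseteq> J"
  shows "\<exists>\<Q>. finite \<Q> \<and> (\<forall>Q\<in>\<Q>. primary_ideal Q class_ring) \<and> \<Inter>\<Q> = J"
proof (rule ccontr)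
  define dec where "dec J \<longleftrightarrow> (\<exists>\<Q>. finite \<Q> \<and> (\<forall>Q\<in>\<Q>. primary_ideal Q class_ring) \<and> \<Inter>\<Q> = J)"
    for J :: "'a set"
  let ?F = "{J. ideal J class_ring \<and> I \<subseteq> J \<and> \<not> dec J}"
  assume "\<not> ?thesis"
  with assms have "J \<in> ?F" by (simp add: dec_def)
  then have "\<exists>J\<in>?F. \<forall>J'\<in>?F. J \<subseteq> J' \<longrightarrow> J' = J" by (intro acc) auto
  then obtain J where J_F: "J \<in> ?F" and J_max: "\<forall>J'\<in>?F. J \<subseteq> J' \<longrightarrow> J' = J" by (elim bexE)
  then have J: "ideal J class_ring" and I: "I \<subseteq> J" and J_dec: "\<not> dec J" by simp_all
  have max: "dec J'" if "ideal J' class_ring" "J \<subset> J'" for J'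
    using J_max[rule_format, of J'] that I by auto
  \<comment> \<open>\<open>UNIV\<close> is the intersection of the empty family, hence
    decomposable.\<close>
  have "J \<noteq> UNIV" using J_dec unfolding dec_def by force
  moreover have "\<not> primary_ideal J class_ring"
  proof
    assume "primary_ideal J class_ring"
    then have "dec J" unfolding dec_def by (intro exI[of _ "{J}"]) simp
    with J_dec show False by blast
  qed
  ultimately obtain a b where ab: "a * b \<in> J" "a \<notin> J" "\<And>k. b ^ k \<notin> J"
    using J unfolding primary_ideal_class_ring_iff by blast
  define colon where "colon k = {x. x * b ^ k \<in> J}" for k :: nat
  have colon_ideal: "ideal (colon k) class_ring" for k
    by (rule ideal_class_ringI) (auto simp: colon_def distrib_right mult.assoc J ideal_zero ideal_add ideal_mult)
  have J_colon: "J \<subseteq> colon k" for k by (auto simp: colon_def J ideal_mult_right)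
  have colon_mono: "colon k \<subseteq> colon l" if "k \<le> l" for k l
  proof
    fix x assume "x \<in> colon k"
    then have "x * b ^ k * b ^ (l - k) \<in> J" by (simp add: colon_def J ideal_mult_right)
    with that show "x \<in> colon l" by (simp add: colon_def mult.assoc flip: power_add)
  qed
  have "\<exists>C\<in>range colon. \<forall>C'\<in>range colon. C \<subseteq> C' \<longrightarrow> C' = C"
    using colon_ideal J_colon I by (intro acc) blast+
  then obtain k where k: "\<And>l. colon k \<subseteq> colon l \<Longrightarrow> colon l = colon k" by auto
  \<comment> \<open>The successor supplies a factor \<open>b\<close>: from
    \<open>a * b \<in> J\<close> follows \<open>a \<in> colon n\<close>, so \<open>colon n\<close>
    is strictly larger than \<open>J\<close>.\<close>
  define n where "n = Suc k"
  have stable: "colon (n + n) = colon n"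
    using k[of "n + n"] k[of n] colon_mono[of k "n + n"] colon_mono[of k n] by (simp add: n_def)
  define J' where "J' = {x + r * b ^ n | x r. x \<in> J}"
  have J'I: "x + r * b ^ n \<in> J'" if "x \<in> J" for x r unfolding J'_def using that by blast
  have J_J': "J \<subseteq> J'" using J'I[of _ 0] by auto
  have J'_ideal: "ideal J' class_ring" unfolding J'_def by (rule ideal_add_multiples[OF J])
  have "a * b * b ^ k \<in> J" using ab(1) J by (rule ideal_mult_right[rotated])
  then have "a \<in> colon n" by (simp add: colon_def n_def mult.assoc)
  then have "dec (colon n)" using max[OF colon_ideal] J_colon ab(2) by blast
  moreover have "dec J'"
  proof (rule max[OF J'_ideal])
    show "J \<subset> J'" using J_J' J'I[OF ideal_zero[OF J], of 1] ab(3)[of n] by auto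
  qed
  ultimately obtain \<Q> \<Q>' where "finite \<Q>" "\<forall>Q\<in>\<Q>. primary_ideal Q class_ring" "\<Inter>\<Q> = colon n"
    "finite \<Q>'" "\<forall>Q\<in>\<Q>'. primary_ideal Q class_ring" "\<Inter>\<Q>' = J'" unfolding dec_def by blast
  then have "dec (colon n \<inter> J')" unfolding dec_def by (intro exI[of _ "\<Q> \<union> \<Q>'"]) auto
  moreover have "colon n \<inter> J' = J"
  proof
    show "colon n \<inter> J' \<subseteq> J"
    proof
      fix y assume y: "y \<in> colon n \<inter> J'"
      then obtain x r where xr: "y = x + r * b ^ n" "x \<in> J" unfolding J'_def by blast
      \<comment> \<open>One more factor \<open>b ^ n\<close> brings \<open>r * b ^ (n + n)\<close>
        into \<open>J\<close>; stability of the colon ideals then lowers the exponent back to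
        \<open>n\<close>.\<close>
      have "y * b ^ n - x * b ^ n \<in> J"
        using y xr(2) J by (auto simp: colon_def ideal_diff ideal_mult_right)
      then have "r \<in> colon (n + n)" by (simp add: xr(1) colon_def power_add algebra_simps)
      then have "r * b ^ n \<in> J" by (simp add: stable) (simp add: colon_def)
      with xr J show "y \<in> J" by (simp add: ideal_add)
    qed
    show "J \<subseteq> colon n \<inter> J'" using J_colon J_J' by simp
  qed
  ultimately show False using J_dec by simp
qed

lemma irredundant_primary_decomposition_exists:
  assumes I: "ideal I class_ring"
  shows "\<exists>\<Q>. finite \<Q> \<and> (\<forall>Q\<in>\<Q>. primary_ideal Q class_ring) \<and> \<Inter>\<Q> = I \<and>
    inj_on (radical class_ring) \<Q> \<and> (\<forall>Q\<in>\<Q>. \<Inter>(\<Q> - {Q}) \<noteq> I)"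
proof -
  define dec where "dec \<Q> \<longleftrightarrow> finite \<Q> \<and> (\<forall>Q\<in>\<Q>. primary_ideal Q class_ring) \<and> \<Inter>\<Q> = I"
    for \<Q> :: "'a set set"
  obtain \<Q>0 where \<Q>0: "dec \<Q>0" using ideal_eq_Inter_primary[OF I] unfolding dec_def by blast
  obtain \<Q> where \<Q>: "dec \<Q>" and least: "\<And>\<Q>'. dec \<Q>' \<Longrightarrow> card \<Q> \<le> card \<Q>'"
    using ex_has_least_nat[of dec \<Q>0 card, OF \<Q>0] by metis
  have fin: "finite \<Q>" and Inter: "\<Inter>\<Q> = I" using \<Q> unfolding dec_def by auto
  have "\<Inter>(\<Q> - {Q}) \<noteq> I" if "Q \<in> \<Q>" for Q
  proof
    assume "\<Inter>(\<Q> - {Q}) = I"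
    then have "card \<Q> \<le> card (\<Q> - {Q})" using \<Q> by (intro least) (auto simp: dec_def)
    with card_Diff1_less[OF fin that] show False by simp
  qed
  moreover have "inj_on (radical class_ring) \<Q>"
  proof (rule inj_onI, rule ccontr)
    fix Q Q' assume QQ': "Q \<in> \<Q>" "Q' \<in> \<Q>" "radical class_ring Q = radical class_ring Q'" "Q \<noteq> Q'"
    let ?\<Q> = "insert (Q \<inter> Q') (\<Q> - {Q, Q'})"
    have "\<Inter>?\<Q> = \<Inter>\<Q>" using QQ'(1,2) by blast
    then have "dec ?\<Q>" using \<Q> QQ' primary_ideal_Int unfolding dec_def by auto
    then have "card \<Q> \<le> card ?\<Q>" by (rule least)
    also have "\<dots> \<le> Suc (card (\<Q> - {Q, Q'}))" by (simp add: card_insert_le_m1 fin card_insert_if)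
    also have "card (\<Q> - {Q, Q'}) = card \<Q> - 2" using QQ' fin by (simp add: card_Diff_subset)
    finally have "card \<Q> \<le> Suc (card \<Q> - 2)" .
    \<comment> \<open>Rules out truncation in \<open>card \<Q> - 2\<close>.\<close>
    moreover have "2 \<le> card \<Q>"
      using card_mono[OF fin, of "{Q, Q'}"] QQ' by simp
    ultimately show False by simp
  qed
  ultimately show ?thesis using \<Q> unfolding dec_def by blast
qed

end

section \<open>The socle of a local Gorenstein ring\<close>

lemma socle_smult_coset:
  assumes "cring A" "ideal m A" "x \<in> annihilator A m" "a \<in> carrier A"
  shows "(m +>\<^bsub>A\<^esub> a) \<odot>\<^bsub>socle A m\<^esub> x = a \<otimes>\<^bsub>A\<^esub> x"
proof -
  interpret cring A by fact
  interpret m: ideal m A by fact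
  have x: "x \<in> carrier A" "\<And>h. h \<in> m \<Longrightarrow> h \<otimes>\<^bsub>A\<^esub> x = \<zero>\<^bsub>A\<^esub>"
    using assms(3) m.Icarr by (auto simp: annihilator_def m_comm)
  have "(\<lambda>b. b \<otimes>\<^bsub>A\<^esub> x) ` (m +>\<^bsub>A\<^esub> a) = {a \<otimes>\<^bsub>A\<^esub> x}"
  proof -
    have "(h \<oplus>\<^bsub>A\<^esub> a) \<otimes>\<^bsub>A\<^esub> x = a \<otimes>\<^bsub>A\<^esub> x" if "h \<in> m" for h
      using x(1) x(2)[OF that] m.Icarr[OF that] assms(4) by (simp add: l_distr)
    moreover have "\<exists>h. h \<in> m" using m.zero_closed by blast
    ultimately show ?thesis by (auto simp: a_r_coset_def' image_iff)
  qed
  then show ?thesis by (simp add: socle_def)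
qed

lemma vectorspace_socle:
  assumes A: "cring A" and m: "maximalideal m A"
  shows "vectorspace (A Quot m) (socle A m)"
proof -
  interpret cring A by fact
  interpret m: maximalideal m A by fact
  have coset: "a_r_coset A m a \<odot>\<^bsub>socle A m\<^esub> x = a \<otimes>\<^bsub>A\<^esub> x"
    if "x \<in> annihilator A m" "a \<in> carrier A" for x a
    using that by (rule socle_smult_coset[OF A m.is_ideal])
  have carr: "x \<in> carrier A" if "x \<in> annihilator A m" for x
    using that by (simp add: annihilator_def)
  have closed: "\<zero>\<^bsub>A\<^esub> \<in> annihilator A m"
    "\<And>x y. x \<in> annihilator A m \<Longrightarrow> y \<in> annihilator A m \<Longrightarrow> x \<oplus>\<^bsub>A\<^esub> y \<in> annihilator A m"
    "\<And>a x. x \<in> annihilator A m \<Longrightarrow> a \<in> carrier A \<Longrightarrow> a \<otimes>\<^bsub>A\<^esub> x \<in> annihilator A m"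
    "\<And>x. x \<in> annihilator A m \<Longrightarrow> \<ominus>\<^bsub>A\<^esub> x \<in> annihilator A m"
    using m.Icarr by (auto simp: annihilator_def l_distr m_assoc l_minus)
  have Quot: "carrier (A Quot m) = {a_r_coset A m a | a. a \<in> carrier A}"
    by (auto simp: FactRing_def A_RCOSETS_def')
  have Quot_add: "a_r_coset A m a \<oplus>\<^bsub>A Quot m\<^esub> a_r_coset A m b = a_r_coset A m (a \<oplus>\<^bsub>A\<^esub> b)"
    and Quot_mult: "a_r_coset A m a \<otimes>\<^bsub>A Quot m\<^esub> a_r_coset A m b = a_r_coset A m (a \<otimes>\<^bsub>A\<^esub> b)"
    if "a \<in> carrier A" "b \<in> carrier A" for a b
    using that by (simp_all add: FactRing_def m.a_rcos_sum m.rcoset_mult_add)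
  have Quot_one: "\<one>\<^bsub>A Quot m\<^esub> = a_r_coset A m \<one>\<^bsub>A\<^esub>" by (simp add: FactRing_def)
  have socle: "carrier (socle A m) = annihilator A m" "add (socle A m) = add A"
    "zero (socle A m) = zero A" by (simp_all add: socle_def)
  show ?thesis
  proof (rule vs_criteria)
    show "field (A Quot m)" by (rule m.quotient_is_field) (rule A)
    show "\<forall>v\<in>carrier (socle A m). \<exists>w\<in>carrier (socle A m). v \<oplus>\<^bsub>socle A m\<^esub> w = \<zero>\<^bsub>socle A m\<^esub>"
      using closed(4) carr r_neg by (auto simp: socle)
  qed (auto simp: socle Quot Quot_add Quot_mult Quot_one coset closed carr a_ac l_distr r_distr m_assoc)
qed

text \<open>On a line over the residue field any nonzero vector reaches every other one by a scalar,
  and the scalar lifts to \<open>A\<close>. The Gorenstein hypothesis enters the argument in this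
  form.\<close>

lemma gorenstein_local_socle:
  assumes gor: "gorenstein_local A" and m: "maximalideal m A"
    and x: "x \<in> annihilator A m" "x \<noteq> \<zero>\<^bsub>A\<^esub>" and y: "y \<in> annihilator A m"
  shows "\<exists>p\<in>carrier A. y = p \<otimes>\<^bsub>A\<^esub> x"
proof -
  obtain m' where A: "cring A" and m': "{m'. maximalideal m' A} = {m'}"
    and "vectorspace.fin_dim (A Quot m') (socle A m')" "vectorspace.dim (A Quot m') (socle A m') = 1"
    using gor unfolding gorenstein_local_def by blast
  moreover have "m' = m" using m m' by blast
  ultimately have fin: "vectorspace.fin_dim (A Quot m) (socle A m)"
    and dim: "vectorspace.dim (A Quot m) (socle A m) = 1" by simp_all
  interpret cring A by fact
  interpret m: maximalideal m A by fact
  interpret S: vectorspace "A Quot m" "socle A m" by (rule vectorspace_socle[OF A m])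
  have carr: "carrier (socle A m) = annihilator A m" and zero: "\<zero>\<^bsub>socle A m\<^esub> = \<zero>\<^bsub>A\<^esub>"
    by (simp_all add: socle_def)
  obtain B where B: "finite B" "S.basis B" using S.finite_basis_exists fin by blast
  then have "card B = 1" using S.dim_basis dim by simp
  then obtain e where e: "B = {e}" by (rule card_1_singletonE)
  with B have e_carr: "e \<in> carrier (socle A m)" and span: "S.span {e} = carrier (socle A m)"
    unfolding S.basis_def by auto
  have multiple: "\<exists>c\<in>carrier (A Quot m). z = c \<odot>\<^bsub>socle A m\<^esub> e" if "z \<in> carrier (socle A m)" for z
  proof -
    from that span S.finite_span[of "{e}"] e_carr
    obtain c where "c \<in> {e} \<rightarrow> carrier (A Quot m)" "z = S.lincomb c {e}" by auto
    with e_carr show ?thesis by (auto simp: S.lincomb_def)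
  qed
  from multiple[of x] multiple[of y] x y carr obtain c d
    where c: "c \<in> carrier (A Quot m)" "x = c \<odot>\<^bsub>socle A m\<^esub> e"
      and d: "d \<in> carrier (A Quot m)" "y = d \<odot>\<^bsub>socle A m\<^esub> e" by auto
  have c0: "c \<noteq> \<zero>\<^bsub>A Quot m\<^esub>" using c(2) x(2) e_carr zero by auto
  let ?k = "d \<otimes>\<^bsub>A Quot m\<^esub> inv\<^bsub>A Quot m\<^esub> c"
  have inv: "inv\<^bsub>A Quot m\<^esub> c \<in> carrier (A Quot m)" "inv\<^bsub>A Quot m\<^esub> c \<otimes>\<^bsub>A Quot m\<^esub> c = \<one>\<^bsub>A Quot m\<^esub>"
    using c(1) c0 S.field_Units by auto
  have "?k \<odot>\<^bsub>socle A m\<^esub> x = (?k \<otimes>\<^bsub>A Quot m\<^esub> c) \<odot>\<^bsub>socle A m\<^esub> e"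
    using c d(1) inv(1) e_carr by (simp add: S.smult_assoc1)
  also have "?k \<otimes>\<^bsub>A Quot m\<^esub> c = d"
    using c(1) d(1) inv by (simp add: S.m_assoc)
  finally have "y = ?k \<odot>\<^bsub>socle A m\<^esub> x" using d(2) by simp
  moreover obtain p where "p \<in> carrier A" "?k = m +>\<^bsub>A\<^esub> p"
    using S.m_closed[OF d(1) inv(1)] by (auto simp: FactRing_def A_RCOSETS_def')
  ultimately show ?thesis
    using socle_smult_coset[OF A m.is_ideal x(1)] by auto
qed

section \<open>Images of ideals under surjective homomorphisms\<close>

context ring_hom_ring
begin

lemma ideal_image:
  assumes J: "ideal J R" and surj: "h ` carrier R = carrier S"
  shows "ideal (h ` J) S"
proof (rule idealI)
  interpret J: ideal J R by fact
  show "ring S" by (rule S.ring_axioms)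
  interpret A: group_hom "add_monoid R" "add_monoid S" h by (rule a_group_hom)
  show "subgroup (h ` J) (add_monoid S)"
    by (rule A.subgroup_img_is_subgroup) (rule J.a_subgroup)
  fix a s assume "a \<in> h ` J" "s \<in> carrier S"
  then obtain x r where xr: "x \<in> J" "a = h x" "r \<in> carrier R" "s = h r" using surj by blast
  then have eq: "s \<otimes>\<^bsub>S\<^esub> a = h (r \<otimes> x)" "a \<otimes>\<^bsub>S\<^esub> s = h (x \<otimes> r)"
    using J.Icarr by simp_all
  show "s \<otimes>\<^bsub>S\<^esub> a \<in> h ` J" "a \<otimes>\<^bsub>S\<^esub> s \<in> h ` J"
    unfolding eq using J.I_l_closed J.I_r_closed xr by blast+
qed

text \<open>Ideals above the image pull back to ideals above \<open>M\<close>; the condition on the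
  kernel keeps the image proper. Used to recognise the maximal ideal of a local quotient.\<close>

lemma maximalideal_image:
  assumes M: "maximalideal M R" and surj: "h ` carrier R = carrier S"
    and ker: "\<And>x. x \<in> carrier R \<Longrightarrow> h x = \<zero>\<^bsub>S\<^esub> \<Longrightarrow> x \<in> M"
  shows "maximalideal (h ` M) S"
proof (rule maximalidealI)
  interpret M: maximalideal M R by fact
  show "ideal (h ` M) S" by (rule ideal_image[OF M.is_ideal surj])
  show "carrier S \<noteq> h ` M"
  proof
    assume "carrier S = h ` M"
    then obtain x where x: "x \<in> M" "h x = \<one>\<^bsub>S\<^esub>" by (metis S.one_closed imageE)
    then have "h (\<one> \<ominus> x) = \<zero>\<^bsub>S\<^esub>"
      using M.Icarr by (simp add: R.minus_eq S.r_neg)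
    then have "\<one> \<ominus> x \<in> M" using ker M.Icarr x(1) by simp
    then have "(\<one> \<ominus> x) \<oplus> x \<in> M" using x(1) by (rule M.a_closed)
    then have "\<one> \<in> M" using M.Icarr[OF x(1)] by (simp add: R.minus_eq R.a_assoc R.l_neg)
    then show False using M.one_imp_carrier M.I_notcarr by blast
  qed
  fix J assume J: "ideal J S" "h ` M \<subseteq> J" "J \<subseteq> carrier S"
  let ?J = "{x \<in> carrier R. h x \<in> J}"
  have "ideal ?J R" by (rule ideal_vimage[OF J(1)])
  moreover have "M \<subseteq> ?J" using J(2) M.Icarr by blast
  ultimately have "?J = M \<or> ?J = carrier R" using M.I_maximal by blast
  moreover have "h ` ?J = J" using J(3) unfolding surj[symmetric] by auto
  ultimately show "J = h ` M \<or> J = carrier S" using surj by metis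
qed

end

section \<open>Minimal overideals\<close>

context finite_codim_ideal
begin

text \<open>The preimages in \<open>P\<close> of the minimal nonzero ideals of
  \<open>R\<close>.\<close>

definition minimal_over :: "('n, 'k) mpoly set \<Rightarrow> bool" where
  "minimal_over A \<longleftrightarrow> ideal A class_ring \<and> I \<subset> A \<and>
     (\<forall>J. ideal J class_ring \<longrightarrow> I \<subset> J \<longrightarrow> J \<subseteq> A \<longrightarrow> J = A)"

text \<open>The ideal quotient I : A, that is, the annihilator of \<open>A\<close> modulo
  \<open>I\<close> when \<open>A\<close> is an overideal.\<close>

definition colon :: "('n, 'k) mpoly set \<Rightarrow> ('n, 'k) mpoly set" where
  "colon A = {x. \<forall>a\<in>A. x * a \<in> I}"

lemma exists_minimal_over:
  assumes N: "ideal N class_ring" "I \<subset> N"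
  obtains A where "minimal_over A" "A \<subseteq> N"
proof -
  let ?F = "{J. ideal J class_ring \<and> I \<subset> J \<and> J \<subseteq> N}"
  have "\<exists>A\<in>?F. \<forall>J\<in>?F. J \<subseteq> A \<longrightarrow> J = A"
    by (rule exists_minimal_ideal[of N]) (use N in auto)
  then obtain A where A: "A \<in> ?F" "\<forall>J\<in>?F. J \<subseteq> A \<longrightarrow> J = A" by (elim bexE)
  have "minimal_over A"
    unfolding minimal_over_def
  proof (intro conjI allI impI)
    fix J assume J: "ideal J class_ring" "I \<subset> J" "J \<subseteq> A"
    with A(1) have "J \<in> ?F" by auto
    with A(2) J(3) show "J = A" by blast
  qed (use A(1) in simp_all)
  with A(1) show thesis using that by simp
qed

context
  fixes A :: "('n, 'k) mpoly set"
  assumes A: "minimal_over A"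
begin

lemma ideal_A: "ideal A class_ring" and I_A: "I \<subseteq> A" and exists_not_in_I: "\<exists>a\<in>A. a \<notin> I"
  using A unfolding minimal_over_def by auto

text \<open>\<open>I\<close> together with the multiples of \<open>a\<close> is an ideal strictly
  above \<open>I\<close> and inside \<open>A\<close>, so minimality makes it all of
  \<open>A\<close>.\<close>

lemma minimal_over_generated:
  assumes a: "a \<in> A" "a \<notin> I" and b: "b \<in> A"
  shows "\<exists>p. b - p * a \<in> I"
proof -
  let ?J = "{x + r * a | x r. x \<in> I}"
  have J_I: "x + r * a \<in> ?J" if "x \<in> I" for x r using that by blast
  have "I \<subseteq> ?J" using J_I[of _ 0] by (simp add: subset_iff)
  moreover have "a \<in> ?J" using J_I[OF ideal_zero[OF I], of 1] by simp
  moreover have "?J \<subseteq> A"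
    using a(1) I_A ideal_A by (auto intro!: ideal_add ideal_mult)
  ultimately have "?J = A"
    using A ideal_add_multiples[OF I, of a] a(2) unfolding minimal_over_def by blast
  with b obtain p h where "b = h + p * a" "h \<in> I" by blast
  then show ?thesis by (intro exI[of _ p]) simp
qed

lemma colon_iff:
  assumes a: "a \<in> A" "a \<notin> I"
  shows "x \<in> colon A \<longleftrightarrow> x * a \<in> I"
proof
  assume x: "x * a \<in> I"
  show "x \<in> colon A"
    unfolding colon_def
  proof (intro CollectI ballI)
    fix b assume "b \<in> A"
    then obtain p where p: "b - p * a \<in> I" using minimal_over_generated[OF a] by blast
    have "x * (b - p * a) + p * (x * a) \<in> I"
      by (rule ideal_add[OF I ideal_mult[OF I p] ideal_mult[OF I x]])
    then show "x * b \<in> I" by (simp add: algebra_simps)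
  qed
qed (use a in \<open>simp add: colon_def\<close>)

lemma colon_ideal: "ideal (colon A) class_ring"
  by (rule ideal_class_ringI)
    (auto simp: colon_def distrib_right mult.assoc I ideal_zero ideal_add ideal_mult)

lemma one_not_in_colon: "1 \<notin> colon A"
  using exists_not_in_I by (auto simp: colon_def)

text \<open>If \<open>x\<close> does not annihilate \<open>A\<close> modulo \<open>I\<close>, then
  \<open>x * a\<close> is again a generator, and the multiplier leading back to \<open>a\<close>
  inverts \<open>x\<close> modulo \<open>colon A\<close>.\<close>

lemma colon_inverse:
  assumes "x \<notin> colon A"
  shows "\<exists>y. 1 - y * x \<in> colon A"
proof -
  obtain a where a: "a \<in> A" "a \<notin> I" using exists_not_in_I by blast
  have "x * a \<in> A" "x * a \<notin> I" using assms colon_iff[OF a] a(1) ideal_A ideal_mult by auto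
  then obtain y where "a - y * (x * a) \<in> I" using minimal_over_generated a(1) by blast
  then show ?thesis
    using colon_iff[OF a] by (intro exI[of _ y]) (simp add: algebra_simps)
qed

lemma maximalideal_colon: "maximalideal (colon A) class_ring"
proof (rule maximalidealI[OF colon_ideal])
  show "carrier class_ring \<noteq> colon A" using one_not_in_colon by auto
  fix J assume J: "ideal J class_ring" "colon A \<subseteq> J"
  show "J = colon A \<or> J = carrier class_ring"
  proof (cases "J = colon A")
    case False
    with J(2) obtain x where "x \<in> J" "x \<notin> colon A" by blast
    then obtain y where "1 - y * x \<in> J" "y * x \<in> J"
      using colon_inverse J by (meson ideal_mult subsetD)
    then have "1 - y * x + y * x \<in> J" using J(1) ideal_add by blast
    then have "p \<in> J" for p using ideal_mult[OF J(1), of 1 p] by simp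
    then show ?thesis by auto
  qed simp
qed

text \<open>Multiplication by an element of \<open>A - I\<close> induces an isomorphism between \<open>P\<close> modulo \<open>colon A\<close> and
  \<open>A\<close> modulo \<open>I\<close>.\<close>

lemma sub_dim_minimal_over: "sub_dim I (residue_class I ` A) = dim_R (colon A)"
proof -
  obtain a where a: "a \<in> A" "a \<notin> I" using exists_not_in_I by blast
  \<comment> \<open>The range of \<open>pr\<close> is a complement of \<open>colon A\<close>. It
    parametrises both spaces: one by residue classes, the other after multiplication by
    \<open>a\<close>.\<close>
  obtain pr where pr: "Vector_Spaces.linear scale_poly scale_poly pr" "\<And>x. x - pr x \<in> colon A"
      "\<And>x. x \<in> colon A \<Longrightarrow> pr x = 0"
    using P.exists_projection[OF ideal_subspace[OF colon_ideal]] by blast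
  interpret pr: Vector_Spaces.linear scale_poly scale_poly pr by (rule pr(1))
  have sub: "P.subspace (range pr)" using pr.subspace_image[OF P.subspace_UNIV] .
  have pr_eqI: "x = y" if "x \<in> range pr" "y \<in> range pr" "x - y \<in> colon A" for x y
  proof -
    from that(1,2) obtain p q where pq: "x = pr p" "y = pr q" by (elim imageE)
    have "p - q = (p - pr p) + (x - y) - (q - pr q)" by (simp add: pq)
    then have "p - q \<in> colon A" using pr(2) that(3) colon_ideal by (metis ideal_add ideal_diff)
    then show ?thesis using pr(3)[of "p - q"] pq by (simp add: pr.diff)
  qed
  have "residue_class (colon A) ` UNIV = residue_class (colon A) ` (\<lambda>x. x) ` range pr"
  proof -
    have "residue_class (colon A) p = residue_class (colon A) (pr p)" for p
      using pr(2) by (simp add: residue_class_eq_iff[OF colon_ideal])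
    then show ?thesis by (simp add: image_image)
  qed
  from module_image_quot_alg[OF colon_ideal sub P.linear_ident this]
  interpret M1: module_image scale_poly "range pr" "residue_class (colon A)" "quot_alg (colon A)"
    by (simp add: carrier_quot_alg[OF colon_ideal, symmetric])
  have inj1: "inj_on (residue_class (colon A)) (range pr)"
    by (rule inj_onI) (simp add: residue_class_eq_iff[OF colon_ideal] pr_eqI)
  have lin: "Vector_Spaces.linear scale_poly scale_poly (\<lambda>p. p * a)"
    by (simp add: Vector_Spaces.linear_iff distrib_right P.vector_space_axioms scale_poly_def mult.assoc)
  have image: "residue_class I ` A = residue_class I ` (\<lambda>p. p * a) ` range pr"
  proof (intro equalityI subsetI)
    fix X assume "X \<in> residue_class I ` A"
    then obtain b where b: "b \<in> A" "X = residue_class I b" by blast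
    then obtain p where p: "b - p * a \<in> I" using minimal_over_generated[OF a] by blast
    have "(p - pr p) * a \<in> I" using pr(2) colon_iff[OF a] by blast
    with p have "(b - p * a) + (p - pr p) * a \<in> I" using ideal_add[OF I] by blast
    then have "b - pr p * a \<in> I" by (simp add: algebra_simps)
    then show "X \<in> residue_class I ` (\<lambda>p. p * a) ` range pr"
      using b(2) residue_class_eq_iff[OF I] by blast
  qed (use a(1) ideal_A ideal_mult in blast)
  interpret M2: module_image scale_poly "range pr" "\<lambda>p. residue_class I (p * a)"
    "(quot_alg I)\<lparr>carrier := residue_class I ` A\<rparr>"
    by (rule module_image_quot_alg[OF I sub lin image])
  have inj2: "inj_on (\<lambda>p. residue_class I (p * a)) (range pr)"
  proof (rule inj_onI)
    fix x y assume xy: "x \<in> range pr" "y \<in> range pr" "residue_class I (x * a) = residue_class I (y * a)"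
    then have "(x - y) * a \<in> I" by (simp add: residue_class_eq_iff[OF I] left_diff_distrib)
    then show "x = y" using xy(1,2) pr_eqI colon_iff[OF a] by blast
  qed
  show ?thesis
    unfolding sub_dim_def dim_R_def M2.dim_eq_Least[OF inj2] M1.dim_eq_Least[OF inj1] ..
qed

text \<open>Take \<open>a\<close> in \<open>A\<close> but not in \<open>Q\<close>. Elements of
  \<open>colon A\<close> multiply \<open>a\<close> into \<open>Q\<close>, so primality puts a power
  of them there; conversely, a power in \<open>Q\<close> that is invertible modulo
  \<open>colon A\<close> would force \<open>a\<close> into \<open>Q\<close>.\<close>

lemma radical_eq_colon:
  assumes Q: "primary_ideal Q class_ring" "I \<subseteq> Q" "\<not> A \<subseteq> Q"
  shows "radical class_ring Q = colon A"
proof -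
  obtain a where a: "a \<in> A" "a \<notin> Q" using Q(3) by blast
  then have aI: "a \<notin> I" using Q(2) by blast
  have primary: "x \<in> Q \<or> (\<exists>k. y ^ k \<in> Q)" if "x * y \<in> Q" for x y
    using Q(1) that unfolding primary_ideal_class_ring_iff by blast
  show ?thesis
  proof (intro equalityI subsetI)
    fix x assume "x \<in> colon A"
    then have "a * x \<in> Q" using a(1) Q(2) by (auto simp: colon_def mult.commute)
    then show "x \<in> radical class_ring Q" using primary a(2) unfolding radical_class_ring by blast
  next
    fix x assume "x \<in> radical class_ring Q"
    then obtain k where k: "x ^ k \<in> Q" unfolding radical_class_ring by blast
    have "x ^ k \<in> colon A"
    proof (rule ccontr)
      assume "x ^ k \<notin> colon A"
      then obtain y where "1 - y * x ^ k \<in> colon A" using colon_inverse by blast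
      then have "(1 - y * x ^ k) * a \<in> Q" using colon_iff[OF a(1) aI] Q(2) by blast
      moreover have "y * x ^ k * a \<in> Q"
        using k Q(1) unfolding primary_ideal_class_ring_iff by (simp add: ideal_mult ideal_mult_right)
      ultimately have "(1 - y * x ^ k) * a + y * x ^ k * a \<in> Q"
        using Q(1) ideal_add unfolding primary_ideal_class_ring_iff by blast
      with a(2) show False by (simp add: algebra_simps)
    qed
    \<comment> \<open>Descent on the exponent: if \<open>x\<close> were invertible modulo
      \<open>colon A\<close>, one factor could be cancelled.\<close>
    then show "x \<in> colon A"
    proof (induction k)
      case 0
      then show ?case using one_not_in_colon by simp
    next
      case (Suc k)
      show ?case
      proof (rule ccontr)
        assume "x \<notin> colon A"
        then obtain y where y: "1 - y * x \<in> colon A" using colon_inverse by blast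
        have "x ^ k * (1 - y * x) + y * x ^ Suc k \<in> colon A"
          by (rule ideal_add[OF colon_ideal ideal_mult[OF colon_ideal y]
                ideal_mult[OF colon_ideal Suc.prems]])
        then have "x ^ k \<in> colon A" by (simp add: algebra_simps)
        with Suc.IH \<open>x \<notin> colon A\<close> show False by blast
      qed
    qed
  qed
qed

end

text \<open>Every component that fails to contain \<open>A\<close> has radical
  \<open>colon A\<close>, and different components have different radicals.\<close>

lemma subset_Inter_other_components:
  assumes A: "minimal_over A" and \<Q>: "primary_decomposition I \<Q>" and Q: "Q \<in> \<Q>" "\<not> A \<subseteq> Q"
  shows "A \<subseteq> \<Inter>(\<Q> - {Q})"
proof
  fix x assume x: "x \<in> A"
  have rad: "radical class_ring Q' = colon A" if "Q' \<in> \<Q>" "\<not> A \<subseteq> Q'" for Q'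
  proof (rule radical_eq_colon[OF A _ _ that(2)])
    show "primary_ideal Q' class_ring" "I \<subseteq> Q'"
      using \<Q> that(1) unfolding primary_decomposition_def by blast+
  qed
  show "x \<in> \<Inter>(\<Q> - {Q})"
  proof
    fix Q' assume Q': "Q' \<in> \<Q> - {Q}"
    show "x \<in> Q'"
    proof (rule ccontr)
      assume "x \<notin> Q'"
      with x have "\<not> A \<subseteq> Q'" by blast
      with rad[of Q] rad[of Q'] Q Q' have "radical class_ring Q = radical class_ring Q'" by simp
      moreover have "inj_on (radical class_ring) \<Q>" using \<Q> unfolding primary_decomposition_def by blast
      ultimately show False using Q(1) Q' by (auto dest: inj_onD)
    qed
  qed
qed

lemma minimal_over_component:
  assumes "minimal_over A" "primary_decomposition I \<Q>"
  shows "\<exists>Q\<in>\<Q>. \<not> A \<subseteq> Q"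
proof -
  have "\<Inter>\<Q> = I" using assms(2) unfolding primary_decomposition_def by simp
  with exists_not_in_I[OF assms(1)] show ?thesis by blast
qed

text \<open>The enlarged component is Q + A. By the modular law its intersection with the other
  components is \<open>A\<close>, since they contain \<open>A\<close> and meet \<open>Q\<close> in
  \<open>I\<close>. The dimension is right because \<open>colon A\<close> is the radical of
  \<open>Q\<close>.\<close>

lemma minimal_divisor_minimal_over:
  assumes A: "minimal_over A" and \<Q>: "primary_decomposition I \<Q>" and Q: "Q \<in> \<Q>" "\<not> A \<subseteq> Q"
  shows "minimal_divisor I \<Q> Q A"
proof -
  have prim: "primary_ideal Q class_ring" and IQ: "I \<subseteq> Q" and I_Int: "Q \<inter> \<Inter>(\<Q> - {Q}) = I"
    using \<Q> Q(1) unfolding primary_decomposition_def by auto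
  then have Q_ideal: "ideal Q class_ring" by (simp add: primary_ideal_class_ring_iff)
  have A_sub: "A \<subseteq> \<Inter>(\<Q> - {Q})" by (rule subset_Inter_other_components[OF assms])
  note A_ideal = ideal_A[OF A]
  define Q' where "Q' = Q <+>\<^bsub>class_ring\<^esub> A"
  have Q': "Q' = {q + a | q a. q \<in> Q \<and> a \<in> A}" by (auto simp: Q'_def set_add_def')
  have "ideal Q' class_ring"
    unfolding Q'_def by (rule ring.add_ideals[OF class_ring.ring_axioms Q_ideal A_ideal])
  moreover have "Q \<subset> Q'"
  proof -
    have "q + 0 \<in> Q'" if "q \<in> Q" for q unfolding Q' using that ideal_zero[OF A_ideal] by blast
    moreover have "0 + a \<in> Q'" if "a \<in> A" for a unfolding Q' using that ideal_zero[OF Q_ideal] by blast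
    ultimately show ?thesis using Q(2) by auto
  qed
  moreover have "A = Q' \<inter> \<Inter>(\<Q> - {Q})"
  proof
    have "0 + a \<in> Q'" if "a \<in> A" for a unfolding Q' using that ideal_zero[OF Q_ideal] by blast
    then show "A \<subseteq> Q' \<inter> \<Inter>(\<Q> - {Q})" using A_sub by auto
    show "Q' \<inter> \<Inter>(\<Q> - {Q}) \<subseteq> A"
    proof
      fix x assume x: "x \<in> Q' \<inter> \<Inter>(\<Q> - {Q})"
      then obtain q a where qa: "x = q + a" "q \<in> Q" "a \<in> A" unfolding Q' by blast
      have "q \<in> Q''" if "Q'' \<in> \<Q> - {Q}" for Q''
      proof -
        have "ideal Q'' class_ring"
          using \<Q> that unfolding primary_decomposition_def primary_ideal_class_ring_iff by blast
        moreover have "x \<in> Q''" "a \<in> Q''" using x qa(3) A_sub that by auto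
        ultimately have "x - a \<in> Q''" by (rule ideal_diff)
        then show ?thesis by (simp add: qa(1))
      qed
      then have "q \<in> I" using qa(2) I_Int by blast
      then show "x \<in> A" using qa I_A[OF A] A_ideal by (auto intro: ideal_add)
    qed
  qed
  ultimately have "divisor \<Q> Q A" unfolding divisor_def by blast
  then show ?thesis
    using sub_dim_minimal_over[OF A] radical_eq_colon[OF A prim IQ Q(2)]
    by (simp add: minimal_divisor_def)
qed

section \<open>Orders of residue classes and the Cayley-Bacharach property\<close>

lemma residue_class_in_filt_R_iff:
  "residue_class I a \<in> filt_R I i \<longleftrightarrow> (\<exists>p\<in>filt_P i. a - p \<in> I)"
  by (auto simp: filt_R_def residue_class_eq_iff[OF I])

lemma exists_exhaustive_degree: "\<exists>d::nat. \<forall>a. residue_class I a \<in> filt_R I (int d)"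
proof -
  obtain deg where deg: "t \<in> filt_P (deg t)" for t :: "('n, 'k) mpoly"
    using filt_P_exhaustive by metis
  \<comment> \<open>The inserted 0 keeps \<open>Max\<close> meaningful for empty \<open>T\<close>
    and its value nonnegative, so that \<open>nat\<close> loses nothing.\<close>
  define d where "d = nat (Max (insert 0 (deg ` T)))"
  have "deg t \<le> int d" if "t \<in> T" for t
    using that finite_T by (simp add: d_def)
  then have "T \<subseteq> filt_P (int d)" using deg filt_P_mono by blast
  then have "P.span T \<subseteq> filt_P (int d)" by (rule P.span_minimal) (rule filt_P_subspace)
  then have "nf a \<in> filt_P (int d)" for a using range_nf by blast
  then show ?thesis using residue_class_in_filt_R_iff diff_nf by blast
qed

text \<open>The integers are not well-ordered, so the \<open>LEAST\<close> in
  \<open>ord_filt\<close> needs a lower bound: negative steps of the filtration contain only zero,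
  and the minimum is found among the naturals.\<close>

lemma ord_filt_residue_class:
  assumes a: "a \<notin> I"
  shows "0 \<le> ord_filt I (residue_class I a)"
    and "\<And>i. residue_class I a \<in> filt_R I i \<Longrightarrow> ord_filt I (residue_class I a) \<le> i"
proof -
  let ?P = "\<lambda>i. residue_class I a \<in> filt_R I i"
  have nonneg: "0 \<le> i" if "?P i" for i
  proof (rule ccontr)
    assume "\<not> 0 \<le> i"
    moreover from that obtain p where "p \<in> filt_P i" "a - p \<in> I"
      unfolding residue_class_in_filt_R_iff by blast
    ultimately show False using a filt_P_negative[of p i] by simp
  qed
  obtain d where "?P (int d)" using exists_exhaustive_degree by blast
  define n where "n = (LEAST n. ?P (int n))"
  have n: "?P (int n)" unfolding n_def by (rule LeastI) (rule \<open>?P (int d)\<close>)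
  have le: "int n \<le> i" if "?P i" for i
    using nonneg[OF that] that Least_le[of "\<lambda>n. ?P (int n)" "nat i"] unfolding n_def by simp
  have "ord_filt I (residue_class I a) = int n"
    unfolding ord_filt_def using n le by (rule Least_equality)
  with le show "0 \<le> ord_filt I (residue_class I a)"
    "\<And>i. ?P i \<Longrightarrow> ord_filt I (residue_class I a) \<le> i" by simp_all
qed

text \<open>The orders lie between 0 and a degree that exhausts \<open>R\<close>, so the
  \<open>Max\<close> is attained; a class of that order is missing from the step just below.\<close>

lemma ri_ideal_attained:
  assumes J: "I \<subseteq> J" "\<not> J \<subseteq> I"
  shows "\<exists>a\<in>J. residue_class I a \<notin> filt_R I (ri_ideal I (residue_class I ` J) - 1)"
proof -
  let ?O = "ord_filt I ` (residue_class I ` J - {\<zero>\<^bsub>quot_alg I\<^esub>})"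
  have nonzero: "residue_class I a \<noteq> \<zero>\<^bsub>quot_alg I\<^esub> \<longleftrightarrow> a \<notin> I" for a
    by (simp add: zero_quot_alg[OF I] residue_class_eq_iff[OF I])
  then have O: "?O = (\<lambda>a. ord_filt I (residue_class I a)) ` (J - I)"
    by (simp only: image_image[symmetric]) (rule arg_cong[where f = "image _"], blast)
  obtain d where "\<And>a. residue_class I a \<in> filt_R I (int d)" using exists_exhaustive_degree by blast
  then have "?O \<subseteq> {0..int d}" unfolding O using ord_filt_residue_class by auto
  then have "finite ?O" by (rule finite_subset) simp
  moreover have "?O \<noteq> {}" unfolding O using J(2) by blast
  ultimately have "ri_ideal I (residue_class I ` J) \<in> ?O" unfolding ri_ideal_def by (rule Max_in)
  then obtain a where a: "a \<in> J" "a \<notin> I" "ri_ideal I (residue_class I ` J) = ord_filt I (residue_class I a)"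
    unfolding O by auto
  then have "residue_class I a \<notin> filt_R I (ri_ideal I (residue_class I ` J) - 1)"
    using ord_filt_residue_class(2)[OF a(2)] by force
  with a(1) show ?thesis by blast
qed

lemma cayley_bacharach_minimal_over:
  assumes cb: "cayley_bacharach I" and \<Q>: "primary_decomposition I \<Q>" and A: "minimal_over A"
  shows "\<exists>a\<in>A. residue_class I a \<notin> filt_R I (ri I - 1)"
proof -
  obtain Q where "Q \<in> \<Q>" "\<not> A \<subseteq> Q" using minimal_over_component[OF A \<Q>] by blast
  then have "ri_ideal I (residue_class I ` A) = ri I"
    using cb \<Q> minimal_divisor_minimal_over[OF A \<Q>] unfolding cayley_bacharach_def by blast
  moreover have "\<not> A \<subseteq> I" using exists_not_in_I[OF A] by blast
  ultimately show ?thesis using ri_ideal_attained[OF I_A[OF A]] by simp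
qed

section \<open>Finiteness of the set of minimal overideals\<close>

lemma ring_hom_residue_class: "ring_hom_ring class_ring (quot_alg I) (residue_class I)"
  by (rule ring_hom_ringI)
    (simp_all add: class_ring.ring_axioms cring.axioms(1)[OF cring_quot_alg[OF I]]
      carrier_quot_alg[OF I] add_quot_alg[OF I] mult_quot_alg[OF I] one_quot_alg[OF I])

text \<open>Both \<open>A\<close> and \<open>B\<close> embed into \<open>P/Q\<close>, with images in the one-dimensional socle.\<close>

lemma minimal_over_subset:
  assumes lg: "locally_gorenstein I" and \<Q>: "primary_decomposition I \<Q>" and Q: "Q \<in> \<Q>"
    and A: "minimal_over A" "\<not> A \<subseteq> Q" and B: "minimal_over B" "\<not> B \<subseteq> Q"
  shows "B \<subseteq> A"
proof
  fix b assume b: "b \<in> B"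
  let ?q = "residue_class I ` Q"
  let ?S = "quot_alg I Quot ?q"
  have prim: "primary_ideal Q class_ring" and IQ: "I \<subseteq> Q" and I_Int: "Q \<inter> \<Inter>(\<Q> - {Q}) = I"
    using \<Q> Q unfolding primary_decomposition_def by auto
  have Q_ideal: "ideal Q class_ring" using prim by (simp add: primary_ideal_class_ring_iff)
  have gor: "gorenstein_local ?S" using lg \<Q> Q unfolding locally_gorenstein_def by blast
  interpret res: ring_hom_ring "class_ring :: ('n, 'k) mpoly ring" "quot_alg I" "residue_class I"
    by (rule ring_hom_residue_class)
  have "ideal ?q (quot_alg I)"
    by (rule res.ideal_image[OF Q_ideal]) (simp add: carrier_quot_alg[OF I])
  then interpret q: ideal ?q "quot_alg I" .
  define \<pi> where "\<pi> x = a_r_coset (quot_alg I) ?q (residue_class I x)" for x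
  have "ring_hom_ring class_ring ?S (a_r_coset (quot_alg I) ?q \<circ> residue_class I)"
    by (rule ring_hom_ringI2[OF class_ring.ring_axioms q.quotient_is_ring])
      (rule ring_hom_trans[OF res.homh q.rcos_ring_hom])
  then interpret pi: ring_hom_ring "class_ring :: ('n, 'k) mpoly ring" ?S \<pi>
    by (simp add: \<pi>_def[abs_def] comp_def)
  have surj: "\<pi> ` carrier class_ring = carrier ?S"
    by (auto simp: \<pi>_def FactRing_def A_RCOSETS_def' carrier_quot_alg[OF I])
  have zero: "\<pi> x = \<zero>\<^bsub>?S\<^esub> \<longleftrightarrow> x \<in> Q" for x
  proof -
    have "\<pi> x = \<zero>\<^bsub>?S\<^esub> \<longleftrightarrow> residue_class I x \<in> ?q"
      using q.rcos_const_imp_mem[of "residue_class I x"] res.S.a_rcos_zero[OF q.is_ideal, of "residue_class I x"]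
      by (auto simp: \<pi>_def FactRing_def carrier_quot_alg[OF I])
    also have "\<dots> \<longleftrightarrow> x \<in> Q"
    proof
      assume "residue_class I x \<in> ?q"
      then obtain y where "y \<in> Q" "x - y \<in> Q" using IQ residue_class_eq_iff[OF I] by blast
      then have "x - y + y \<in> Q" using ideal_add[OF Q_ideal] by blast
      then show "x \<in> Q" by simp
    qed simp
    finally show ?thesis .
  qed
  \<comment> \<open>Both are the radical of \<open>Q\<close>, so the images of \<open>A\<close> and
    \<open>B\<close> are killed by the same maximal ideal.\<close>
  have colon_A: "colon A = colon B"
    using radical_eq_colon[OF A(1) prim IQ A(2)] radical_eq_colon[OF B(1) prim IQ B(2)] by simp
  have "colon A = radical class_ring Q" using radical_eq_colon[OF A(1) prim IQ A(2)] ..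
  have Q_colon: "Q \<subseteq> colon A"
  proof
    fix x assume "x \<in> Q"
    then have "x ^ 1 \<in> Q" by simp
    then show "x \<in> colon A" unfolding \<open>colon A = radical class_ring Q\<close> radical_class_ring by blast
  qed
  have max: "maximalideal (\<pi> ` colon A) ?S"
    by (rule pi.maximalideal_image[OF maximalideal_colon[OF A(1)] surj]) (use zero Q_colon in auto)
  have socle: "\<pi> x \<in> annihilator ?S (\<pi> ` colon A)" if "x \<in> A \<union> B" for x
  proof -
    have "\<pi> x \<otimes>\<^bsub>?S\<^esub> \<pi> y = \<zero>\<^bsub>?S\<^esub>" if "y \<in> colon A" for y
    proof -
      have "y \<in> colon B" using that colon_A by simp
      with that \<open>x \<in> A \<union> B\<close> have "y * x \<in> I" unfolding colon_def by blast
      then have "\<pi> (x * y) = \<zero>\<^bsub>?S\<^esub>" using IQ zero by (auto simp: mult.commute)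
      then show ?thesis using pi.hom_mult[of x y] by simp
    qed
    moreover have "\<pi> x \<in> carrier ?S" using surj by auto
    ultimately show ?thesis by (auto simp: annihilator_def)
  qed
  obtain a where a: "a \<in> A" "a \<notin> Q" using A(2) by blast
  obtain r where r: "r \<in> carrier ?S" "\<pi> b = r \<otimes>\<^bsub>?S\<^esub> \<pi> a"
    using gorenstein_local_socle[OF gor max socle _ socle, of a b] a b zero by auto
  then obtain p where "r = \<pi> p" unfolding surj[symmetric] by blast
  with r have "\<pi> b = \<pi> (p * a)" using pi.hom_mult[of p a] by simp
  then have "\<pi> (b - p * a) = \<zero>\<^bsub>?S\<^esub>" using pi.hom_add[of "b - p * a" "p * a"] pi.hom_closed by simp
  then have "b - p * a \<in> Q" using zero by blast
  \<comment> \<open>The socle controls only the component \<open>Q\<close>; the other components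
    contain both \<open>A\<close> and \<open>B\<close>.\<close>
  moreover have "b - p * a \<in> \<Inter>(\<Q> - {Q})"
  proof
    fix Q' assume Q': "Q' \<in> \<Q> - {Q}"
    then have "ideal Q' class_ring"
      using \<Q> unfolding primary_decomposition_def primary_ideal_class_ring_iff by blast
    moreover have "b \<in> Q'" "a \<in> Q'"
      using subset_Inter_other_components[OF A(1) \<Q> Q A(2)] a(1)
        subset_Inter_other_components[OF B(1) \<Q> Q B(2)] b Q' by auto
    ultimately show "b - p * a \<in> Q'" by (intro ideal_diff ideal_mult)
  qed
  ultimately have "b - p * a \<in> I" using I_Int by blast
  then have "b - p * a \<in> A" using I_A[OF A(1)] by blast
  then have "b - p * a + p * a \<in> A" using ideal_A[OF A(1)] a(1) by (intro ideal_add ideal_mult)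
  then show "b \<in> A" by simp
qed

text \<open>Sending a minimal overideal to a component that does not contain it is injective, so
  there are at most as many as components.\<close>

lemma finite_minimal_over:
  assumes lg: "locally_gorenstein I" and \<Q>: "primary_decomposition I \<Q>"
  shows "finite {A. minimal_over A}"
proof -
  have "\<forall>A\<in>{A. minimal_over A}. \<exists>Q. Q \<in> \<Q> \<and> \<not> A \<subseteq> Q"
    using minimal_over_component[OF _ \<Q>, unfolded Bex_def] by simp
  then obtain c where c: "\<forall>A\<in>{A. minimal_over A}. c A \<in> \<Q> \<and> \<not> A \<subseteq> c A" by (elim bchoice[THEN exE])
  have "inj_on c {A. minimal_over A}"
  proof (rule inj_onI)
    fix A B assume A: "A \<in> {A. minimal_over A}" and B: "B \<in> {A. minimal_over A}" and eq: "c A = c B"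
    show "A = B"
    proof
      show "A \<subseteq> B" by (rule minimal_over_subset[OF lg \<Q>, of "c A"]) (use A B c eq in auto)
      show "B \<subseteq> A" by (rule minimal_over_subset[OF lg \<Q>, of "c A"]) (use A B c eq in auto)
    qed
  qed
  moreover have "c ` {A. minimal_over A} \<subseteq> \<Q>" using c by blast
  moreover have "finite \<Q>" using \<Q> unfolding primary_decomposition_def by blast
  ultimately show ?thesis by (metis finite_imageD finite_subset)
qed

section \<open>The inequality under each of the two hypotheses\<close>

lemma HF_add_le_of_cayley_bacharach:
  assumes inf: "infinite (UNIV :: 'k set)" and lg: "locally_gorenstein I" and cb: "cayley_bacharach I"
  shows "HF I i + HF I (ri I - 1 - i) \<le> dim_R I"
proof -
  have "\<exists>\<Q>. primary_decomposition I \<Q>"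
    unfolding primary_decomposition_def
    by (rule irredundant_primary_decomposition_exists[OF _ I]) (rule exists_maximal_ideal)
  then obtain \<Q> where \<Q>: "primary_decomposition I \<Q>" ..
  have "\<forall>A\<in>{A. minimal_over A}. \<exists>a. a \<in> A \<and> residue_class I a \<notin> filt_R I (ri I - 1)"
    using cayley_bacharach_minimal_over[OF cb \<Q>, unfolded Bex_def] by simp
  then obtain s where s: "\<forall>A\<in>{A. minimal_over A}. s A \<in> A \<and> residue_class I (s A) \<notin> filt_R I (ri I - 1)"
    by (elim bchoice[THEN exE])
  \<comment> \<open>The preimage of \<open>filt_R I (ri I - 1)\<close>. Adding \<open>I\<close>
    makes the functional descend to \<open>R\<close>.\<close>
  let ?S = "{p + h | p h. p \<in> filt_P (ri I - 1) \<and> h \<in> I}"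
  have sub: "P.subspace ?S" by (rule P.subspace_sums[OF filt_P_subspace ideal_subspace[OF I]])
  have fin: "finite (s ` {A. minimal_over A})" using finite_minimal_over[OF lg \<Q>] by simp
  have disj: "s ` {A. minimal_over A} \<inter> ?S = {}"
  proof -
    have "residue_class I x \<in> filt_R I (ri I - 1)" if "x \<in> ?S" for x
      using that unfolding residue_class_in_filt_R_iff by force
    with s show ?thesis by blast
  qed
  obtain \<psi> where \<psi>: "Vector_Spaces.linear scale_poly (*) \<psi>" "\<forall>x\<in>?S. \<psi> x = 0"
      "\<forall>x\<in>s ` {A. minimal_over A}. \<psi> x \<noteq> 0"
    using P.exists_common_functional[OF inf sub fin disj] by (elim exE conjE)
  interpret \<psi>: Vector_Spaces.linear scale_poly "(*)" \<psi> by (rule \<psi>(1))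
  have S_zero: "\<psi> (p + h) = 0" if "p \<in> filt_P (ri I - 1)" "h \<in> I" for p h
    using \<psi>(2) that by blast
  have I_zero: "\<psi> h = 0" if "h \<in> I" for h
    using S_zero[OF P.subspace_0[OF filt_P_subspace] that] by simp
  have F_zero: "\<psi> p = 0" if "p \<in> filt_P (ri I - 1)" for p
    using S_zero[OF that ideal_zero[OF I]] by simp
  \<comment> \<open>The preimage of the annihilator of the form that \<psi> induces on
    \<open>R\<close>. If it exceeded \<open>I\<close>, it would contain a minimal overideal.\<close>
  define N where "N = {f. \<forall>g. \<psi> (f * g) = 0}"
  have "ideal N class_ring"
  proof (rule ideal_class_ringI)
    show "r * x \<in> N" if "x \<in> N" for x r
    proof -
      have "\<psi> (r * x * g) = \<psi> (x * (r * g))" for g by (simp add: ac_simps)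
      with that show ?thesis by (simp add: N_def)
    qed
  qed (simp_all add: N_def distrib_right \<psi>.add)
  have "I \<subseteq> N" using I_zero ideal_mult_right[OF I] by (auto simp: N_def)
  have "N \<subseteq> I"
  proof (rule ccontr)
    assume "\<not> N \<subseteq> I"
    with \<open>I \<subseteq> N\<close> have "I \<subset> N" by blast
    then obtain A where A: "minimal_over A" "A \<subseteq> N"
      by (rule exists_minimal_over[OF \<open>ideal N class_ring\<close>])
    with s have "s A \<in> N" by blast
    \<comment> \<open>The choice \<open>g = 1\<close> suffices, as \<psi> was made nonzero at
      \<open>s A\<close>.\<close>
    then have "\<psi> (s A * 1) = 0" unfolding N_def by blast
    with \<psi>(3) A(1) show False by simp
  qed
  then have nondegenerate: "f \<in> I" if "\<And>g. \<psi> (f * g) = 0" for f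
    using that by (auto simp: N_def)
  show ?thesis by (rule HF_add_le[OF \<psi>(1) I_zero nondegenerate F_zero])
qed

text \<open>The form is pulled back along the residue class map. The index \<open>- d - 1\<close>
  makes it vanish on \<open>filt_R I d\<close>; for \<open>d = ri I - 1\<close> it equals
  \<open>- ri I\<close>.\<close>

lemma HF_add_le_of_trivial_annihilator:
  assumes \<phi>: "\<phi> \<in> filt_omega I (- d - 1)" and ann: "ann_omega I \<phi> = {\<zero>\<^bsub>quot_alg I\<^esub>}"
  shows "HF I i + HF I (d - i) \<le> dim_R I"
proof (rule HF_add_le[where \<psi> = "\<lambda>p. \<phi> (residue_class I p)"])
  have hom: "\<phi> \<in> LinearCombinations.module_hom class_ring (quot_alg I) field_module"
    and zero: "\<And>f. f \<in> filt_R I d \<Longrightarrow> \<phi> f = 0"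
    using \<phi> by (auto simp: filt_omega_def canonical_module_def)
  have add: "\<phi> (residue_class I (p + q)) = \<phi> (residue_class I p) + \<phi> (residue_class I q)" for p q
    using LinearCombinations.module_hom_add[OF hom, of "residue_class I p" "residue_class I q"]
    by (simp add: carrier_quot_alg[OF I] add_quot_alg[OF I] field_module_def ring.defs)
  have scale: "\<phi> (residue_class I (scale_poly c p)) = c * \<phi> (residue_class I p)" for c p
    using LinearCombinations.module_hom_smult[OF hom, of c "residue_class I p"]
    by (simp add: carrier_quot_alg[OF I] smult_quot_alg[OF I] field_module_def ring.defs)
  show "Vector_Spaces.linear scale_poly (*) (\<lambda>p. \<phi> (residue_class I p))"
    by (simp add: Vector_Spaces.linear_iff P.vector_space_axioms P.vector_space_mult add scale)
  have "\<phi> (residue_class I 0) = 0" using scale[of 0 0] by simp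
  then show "\<phi> (residue_class I p) = 0" if "p \<in> I" for p
    using that residue_class_eq_iff[OF I, of p 0] by simp
  show "\<phi> (residue_class I p) = 0" if "p \<in> filt_P d" for p
    using zero that by (simp add: filt_R_def)
  show "f \<in> I" if "\<And>g. \<phi> (residue_class I (f * g)) = 0" for f
  proof -
    have "residue_class I f \<odot>\<^bsub>canonical_module I\<^esub> \<phi> = \<zero>\<^bsub>canonical_module I\<^esub>"
      using that by (auto simp: canonical_module_def carrier_quot_alg[OF I] mult_quot_alg[OF I] restrict_def fun_eq_iff)
    then have "residue_class I f \<in> ann_omega I \<phi>" by (simp add: ann_omega_def carrier_quot_alg[OF I])
    then show ?thesis using ann by (simp add: zero_quot_alg[OF I] residue_class_eq_iff[OF I])
  qed
qed

end

theorem corollary5p7: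
  fixes I :: "('n::finite, 'k::field) mpoly set"
  assumes "ideal I class_ring" and "I \<noteq> carrier class_ring"
    and "vectorspace.fin_dim (class_ring :: 'k ring) (quot_alg I)"
  shows "((\<exists>\<phi>\<in>filt_omega I (- ri I). ann_omega I \<phi> = {\<zero>\<^bsub>quot_alg I\<^esub>}) \<longrightarrow>
            (\<forall>i\<in>{0..ri I - 1}. HF I i + HF I (ri I - 1 - i) \<le> dim_R I)) \<and>
         (infinite (UNIV :: 'k set) \<and> locally_gorenstein I \<and> cayley_bacharach I \<longrightarrow>
            (\<forall>i\<in>{0..ri I - 1}. HF I i + HF I (ri I - 1 - i) \<le> dim_R I))"
proof -
  obtain nf T where "finite_codim_ideal I nf T"
    using finite_codim_ideal_exists[OF assms(1,3)] by blast
  then interpret finite_codim_ideal I nf T .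
  show ?thesis
  proof (intro conjI impI ballI)
    fix i
    assume "\<exists>\<phi>\<in>filt_omega I (- ri I). ann_omega I \<phi> = {\<zero>\<^bsub>quot_alg I\<^esub>}"
    then obtain \<phi> where "\<phi> \<in> filt_omega I (- ri I)" "ann_omega I \<phi> = {\<zero>\<^bsub>quot_alg I\<^esub>}" ..
    then show "HF I i + HF I (ri I - 1 - i) \<le> dim_R I"
      by (intro HF_add_le_of_trivial_annihilator[of \<phi>]) simp_all
  next
    fix i
    assume "infinite (UNIV :: 'k set) \<and> locally_gorenstein I \<and> cayley_bacharach I"
    then show "HF I i + HF I (ri I - 1 - i) \<le> dim_R I"
      by (intro HF_add_le_of_cayley_bacharach) simp_all
  qed
qed

end
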